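(* Let $(N,F,d\mu_{BH})$ be a Randers space with navigation data $(h,W)$, where $W$ is a homothetic vector field of $(N,h)$ and $d\mu_{BH}$ is the Busemann--Hausdorff volume form of $F$. Let $f$ be an isoparametric function of the Riemannian manifold $(N,h)$. Then $f$ is an isoparametric function of $(N,F,d\mu_{BH})$ if and only if there is a smooth function $\varphi$ on $f(N_f)$ such that $df(W)=\varphi(f)$ on $N_f=\{x\in N: df(x)\neq0\}$.
   Context: **Randers metrics and navigation data.** Navigation data $(h,W)$ on an $n$-manifold $N$ consist of a Riemannian metric $h$ and a vector field $W=w^i\partial_{x^i}$ with $\|W\|_h<1$. The associated Randers metric is $F(y)=\dfrac{\sqrt{\lambda h(y)^2+w_0^2}-w_0}{\lambda}$, with $\lambda=1-\|W\|_h^2$, $h(y)=\sqrt{h_{ij}y^iy^j}$, $w_i=h_{ij}w^j$, $w_0=w_iy^i$. $W$ is homothetic if $\frac12(w_{i|j}+w_{j|i})=-2k_0h_{ij}$ for some constant $k_0$, where "$|$" is covariant differentiation with respect to $h$. **Finsler gradient and Laplacian.** The Legendre transformation $\mathcal L:TN\to T^*N$ is $\mathcal L(y)=F(y)F_{y^i}(y)\,dx^i$ for $y\ne0$, $\mathcal L(0)=0$. The (nonlinear) gradient of $f$ is $\nabla f=\mathcal L^{-1}(df)$. For a volume form $d\mu=\sigma(x)dx^1\wedge\cdots\wedge dx^n$, the Finsler-Laplacian on $N_f$ is $\Delta f=\mathrm{div}_\sigma(\nabla f)$, the divergence of the vector field $\nabla f$ with respect to $d\mu$. **Isoparametric functions.**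 A non-constant $C^1$ function $f$ on $(N,F,d\mu)$, smooth on $N_f$, is isoparametric if there are a smooth function $\tilde a$ and a continuous function $\tilde b$ on $f(N_f)$ such that $F(\nabla f)=\tilde a(f)$ and $\Delta f=\tilde b(f)$ on $N_f$. For $(N,h)$ the same definition is used with the Riemannian metric $h$ and its Riemannian volume form. *)

theory Defs
  imports "HOL-Analysis.Analysis"
begin

section \<open>Smooth functions on open subsets of Euclidean spaces\<close>

text \<open>Both notions are meant for open \<open>S\<close>, as the derivatives are two-sided.\<close>

primrec Ck_on :: "nat \<Rightarrow> 'a::euclidean_space set \<Rightarrow> ('a \<Rightarrow> 'b::real_normed_vector) \<Rightarrow> bool" where
  "Ck_on 0 S g \<longleftrightarrow> continuous_on S g"
| "Ck_on (Suc k) S g \<longleftrightarrow> (\<forall>x\<in>S. g differentiable (at x)) \<and>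
     (\<forall>v. Ck_on k S (\<lambda>x. frechet_derivative g (at x) v))"

definition smooth_on :: "'a::euclidean_space set \<Rightarrow> ('a \<Rightarrow> 'b::real_normed_vector) \<Rightarrow> bool" where
  "smooth_on S g \<longleftrightarrow> (\<forall>k. Ck_on k S g)"

definition partial :: "'n \<Rightarrow> (real^'n::finite \<Rightarrow> 'b::real_normed_vector) \<Rightarrow> real^'n \<Rightarrow> 'b" where
  "partial i g x = frechet_derivative g (at x) (axis i 1)"


section \<open>Smooth manifolds\<close>

type_synonym ('a, 'n) chart = "'a set \<times> ('a \<Rightarrow> real^'n)"

abbreviation chart_dom :: "('a, 'n) chart \<Rightarrow> 'a set" where
  "chart_dom \<equiv> fst"

abbreviation chart_map :: "('a, 'n) chart \<Rightarrow> 'a \<Rightarrow> real^'n" where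
  "chart_map \<equiv> snd"

abbreviation chart_image :: "('a, 'n) chart \<Rightarrow> (real^'n) set" where
  "chart_image c \<equiv> chart_map c ` chart_dom c"

abbreviation chart_inv :: "('a, 'n) chart \<Rightarrow> real^'n \<Rightarrow> 'a" where
  "chart_inv c \<equiv> inv_into (chart_dom c) (chart_map c)"

definition transition :: "('a, 'n) chart \<Rightarrow> ('a, 'n) chart \<Rightarrow> real^'n \<Rightarrow> real^'n" where
  "transition c d = chart_map d \<circ> chart_inv c"

abbreviation overlap :: "('a, 'n) chart \<Rightarrow> ('a, 'n) chart \<Rightarrow> (real^'n) set" where
  "overlap c d \<equiv> chart_map c ` (chart_dom c \<inter> chart_dom d)"

definition jacobian :: "('a, 'n::finite) chart \<Rightarrow> ('a, 'n) chart \<Rightarrow> real^'n \<Rightarrow> real^'n^'n" where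
  "jacobian c d x = matrix (frechet_derivative (transition c d) (at x))"

definition smooth_manifold :: "'a topology \<Rightarrow> ('a, 'n::finite) chart set \<Rightarrow> bool" where
  "smooth_manifold N A \<longleftrightarrow>
     Hausdorff_space N \<and> second_countable N \<and>
     (\<Union>c\<in>A. chart_dom c) = topspace N \<and>
     (\<forall>c\<in>A. openin N (chart_dom c) \<and> open (chart_image c) \<and>
        homeomorphic_map (subtopology N (chart_dom c)) (top_of_set (chart_image c)) (chart_map c)) \<and>
     (\<forall>c\<in>A. \<forall>d\<in>A. smooth_on (overlap c d) (transition c d))"


section \<open>Tensor fields in local coordinates\<close>

text \<open>
  A field on the manifold is given by its components in every chart of the atlas, as functions
  of the coordinates \<open>x \<in> chart_image c\<close>, subject to the usual transformation law.
  Thus \<open>h c x $ i $ j\<close> is \<open>h\<^sub>i\<^sub>j\<close> and \<open>W c x $ i\<close> is \<open>w\<^sup>i\<close> in the chart \<open>c\<close>.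
  A Finsler metric \<open>F c x y\<close> is evaluated at the tangent vector with components \<open>y\<close>, and a
  volume form \<open>\<sigma> c x dx\<^sup>1 \<and> \<dots> \<and> dx\<^sup>n\<close> is given by its density \<open>\<sigma> c x\<close>.
\<close>

type_synonym ('a, 'n) metric_field = "('a, 'n) chart \<Rightarrow> real^'n \<Rightarrow> real^'n^'n"
type_synonym ('a, 'n) vec_field = "('a, 'n) chart \<Rightarrow> real^'n \<Rightarrow> real^'n"
type_synonym ('a, 'n) finsler = "('a, 'n) chart \<Rightarrow> real^'n \<Rightarrow> real^'n \<Rightarrow> real"
type_synonym ('a, 'n) density = "('a, 'n) chart \<Rightarrow> real^'n \<Rightarrow> real"

definition riemannian_metric :: "('a, 'n::finite) chart set \<Rightarrow> ('a, 'n) metric_field \<Rightarrow> bool" where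
  "riemannian_metric A h \<longleftrightarrow>
     (\<forall>c\<in>A. smooth_on (chart_image c) (h c) \<and>
        (\<forall>x\<in>chart_image c. transpose (h c x) = h c x \<and> (\<forall>y. y \<noteq> 0 \<longrightarrow> 0 < y \<bullet> (h c x *v y)))) \<and>
     (\<forall>c\<in>A. \<forall>d\<in>A. \<forall>x\<in>overlap c d.
        h c x = transpose (jacobian c d x) ** h d (transition c d x) ** jacobian c d x)"

definition vector_field :: "('a, 'n::finite) chart set \<Rightarrow> ('a, 'n) vec_field \<Rightarrow> bool" where
  "vector_field A W \<longleftrightarrow>
     (\<forall>c\<in>A. smooth_on (chart_image c) (W c)) \<and>
     (\<forall>c\<in>A. \<forall>d\<in>A. \<forall>x\<in>overlap c d. W d (transition c d x) = jacobian c d x *v W c x)"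

definition riem_norm :: "('a, 'n::finite) metric_field \<Rightarrow> ('a, 'n) finsler" where
  "riem_norm h c x y = sqrt (\<Sum>i\<in>UNIV. \<Sum>j\<in>UNIV. h c x $ i $ j * y $ i * y $ j)"

definition riem_density :: "('a, 'n::finite) metric_field \<Rightarrow> ('a, 'n) density" where
  "riem_density h c x = sqrt (det (h c x))"

definition lower :: "('a, 'n::finite) metric_field \<Rightarrow> ('a, 'n) vec_field \<Rightarrow> ('a, 'n) vec_field" where
  "lower h W c x = (\<chi> i. \<Sum>j\<in>UNIV. h c x $ i $ j * W c x $ j)"

text \<open>\<open>christoffel h c x k i j\<close> is \<open>\<Gamma>\<^sup>k\<^sub>i\<^sub>j\<close>.\<close>

definition christoffel ::
    "('a, 'n::finite) metric_field \<Rightarrow> ('a, 'n) chart \<Rightarrow> real^'n \<Rightarrow> 'n \<Rightarrow> 'n \<Rightarrow> 'n \<Rightarrow> real" where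
  "christoffel h c x k i j =
     (\<Sum>l\<in>UNIV. matrix_inv (h c x) $ k $ l / 2 *
        (partial i (\<lambda>z. h c z $ j $ l) x + partial j (\<lambda>z. h c z $ i $ l) x
          - partial l (\<lambda>z. h c z $ i $ j) x))"

text \<open>\<open>cov_deriv h W c x i j\<close> is \<open>w\<^sub>i\<^sub>|\<^sub>j\<close>.\<close>

definition cov_deriv ::
    "('a, 'n::finite) metric_field \<Rightarrow> ('a, 'n) vec_field \<Rightarrow> ('a, 'n) chart \<Rightarrow> real^'n \<Rightarrow> 'n \<Rightarrow> 'n \<Rightarrow> real" where
  "cov_deriv h W c x i j =
     partial j (\<lambda>z. lower h W c z $ i) x
       - (\<Sum>k\<in>UNIV. christoffel h c x k i j * lower h W c x $ k)"

definition homothetic ::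
    "('a, 'n::finite) chart set \<Rightarrow> ('a, 'n) metric_field \<Rightarrow> ('a, 'n) vec_field \<Rightarrow> bool" where
  "homothetic A h W \<longleftrightarrow>
     (\<exists>k0::real. \<forall>c\<in>A. \<forall>x\<in>chart_image c. \<forall>i j.
        (cov_deriv h W c x i j + cov_deriv h W c x j i) / 2 = - 2 * k0 * h c x $ i $ j)"


section \<open>Randers metrics and the Busemann--Hausdorff volume form\<close>

definition navigation_data ::
    "('a, 'n::finite) chart set \<Rightarrow> ('a, 'n) metric_field \<Rightarrow> ('a, 'n) vec_field \<Rightarrow> bool" where
  "navigation_data A h W \<longleftrightarrow>
     riemannian_metric A h \<and> vector_field A W \<and>
     (\<forall>c\<in>A. \<forall>x\<in>chart_image c. riem_norm h c x (W c x) < 1)"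

definition randers :: "('a, 'n::finite) metric_field \<Rightarrow> ('a, 'n) vec_field \<Rightarrow> ('a, 'n) finsler" where
  "randers h W c x y =
     (let lam = 1 - (riem_norm h c x (W c x))\<^sup>2;
          w0 = (\<Sum>i\<in>UNIV. lower h W c x $ i * y $ i)
      in (sqrt (lam * (riem_norm h c x y)\<^sup>2 + w0\<^sup>2) - w0) / lam)"

text \<open>
  The Busemann--Hausdorff density is the Euclidean volume of the unit ball of \<open>\<real>\<^sup>n\<close> divided
  by that of the unit ball \<open>{y. F(x, y\<^sup>i \<partial>\<^sub>i) < 1}\<close> of \<open>F\<close> at \<open>x\<close>.
\<close>

definition BH_density :: "('a, 'n::finite) finsler \<Rightarrow> ('a, 'n) density" where
  "BH_density F c x = measure lborel (ball (0::real^'n) 1) / measure lborel {y. F c x y < 1}"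


section \<open>Gradient, Laplacian and isoparametric functions\<close>

definition local_rep :: "('a, 'n) chart \<Rightarrow> ('a \<Rightarrow> real) \<Rightarrow> real^'n \<Rightarrow> real" where
  "local_rep c f = f \<circ> chart_inv c"

definition differential :: "('a \<Rightarrow> real) \<Rightarrow> ('a, 'n::finite) vec_field" where
  "differential f c x = (\<chi> i. partial i (local_rep c f) x)"

definition regular_set :: "('a, 'n::finite) chart set \<Rightarrow> ('a \<Rightarrow> real) \<Rightarrow> 'a set" where
  "regular_set A f = {p. \<exists>c\<in>A. p \<in> chart_dom c \<and> differential f c (chart_map c p) \<noteq> 0}"

text \<open>Covectors are represented by their components with respect to \<open>dx\<^sup>1, \<dots>, dx\<^sup>n\<close>.\<close>

definition legendre :: "('a, 'n::finite) finsler \<Rightarrow> ('a, 'n) chart \<Rightarrow> real^'n \<Rightarrow> real^'n \<Rightarrow> real^'n" where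
  "legendre F c x y = (if y = 0 then 0 else (\<chi> i. F c x y * partial i (F c x) y))"

text \<open>For a Finsler metric \<open>F\<close> the map \<open>legendre F c x\<close> is bijective, so \<open>inv\<close> is its inverse.\<close>

definition gradient :: "('a, 'n::finite) finsler \<Rightarrow> ('a \<Rightarrow> real) \<Rightarrow> ('a, 'n) vec_field" where
  "gradient F f c x = inv (legendre F c x) (differential f c x)"

definition divergence :: "('a, 'n::finite) density \<Rightarrow> ('a, 'n) vec_field \<Rightarrow> ('a, 'n) chart \<Rightarrow> real^'n \<Rightarrow> real" where
  "divergence \<sigma> X c x = (\<Sum>i\<in>UNIV. partial i (\<lambda>z. \<sigma> c z * X c z $ i) x) / \<sigma> c x"

definition laplacian ::
    "('a, 'n::finite) finsler \<Rightarrow> ('a, 'n) density \<Rightarrow> ('a \<Rightarrow> real) \<Rightarrow> ('a, 'n) chart \<Rightarrow> real^'n \<Rightarrow> real" where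
  "laplacian F \<sigma> f = divergence \<sigma> (gradient F f)"

text \<open>
  For \<open>f\<close> of class \<open>C\<^sup>1\<close>, the set \<open>f ` regular_set A f\<close> is open in \<open>\<real>\<close>,
  so \<open>smooth_on\<close> is appropriate there.
\<close>

definition isoparametric ::
    "('a, 'n::finite) chart set \<Rightarrow> ('a, 'n) finsler \<Rightarrow> ('a, 'n) density \<Rightarrow> ('a \<Rightarrow> real) \<Rightarrow> bool" where
  "isoparametric A F \<sigma> f \<longleftrightarrow>
     \<not> f constant_on (\<Union>c\<in>A. chart_dom c) \<and>
     (\<forall>c\<in>A. Ck_on 1 (chart_image c) (local_rep c f)) \<and>
     (\<forall>c\<in>A. smooth_on (chart_map c ` (chart_dom c \<inter> regular_set A f)) (local_rep c f)) \<and>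
     (\<exists>a b. smooth_on (f ` regular_set A f) a \<and> continuous_on (f ` regular_set A f) b \<and>
        (\<forall>c\<in>A. \<forall>p\<in>chart_dom c \<inter> regular_set A f.
           let x = chart_map c p in
             F c x (gradient F f c x) = a (f p) \<and> laplacian F \<sigma> f c x = b (f p)))"

end

theory Submission
  imports Defs
begin

text \<open>
  The indicatrix of \<open>F\<close> is that of \<open>h\<close> translated by \<open>W\<close>. Hence the Busemann--Hausdorff density of \<open>F\<close> is
  the Riemannian density of \<open>h\<close>, and the dual norm of \<open>df\<close> is \<open>|df| + df(W)\<close>, attained in the direction
  \<open>\<nabla>f / |df| + W\<close>, where \<open>\<nabla>\<close> and \<open>|\<cdot>|\<close> refer to \<open>h\<close>. So if \<open>|df| = a(f)\<close>, then \<open>F(\<nabla>\<^sup>F f) = a(f) + df(W)\<close>,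
  which is a smooth function of \<open>f\<close> iff \<open>df(W)\<close> is. If \<open>df(W) = \<phi>(f)\<close>, put \<open>\<psi> = a + \<phi>\<close>; then
  \<open>\<nabla>\<^sup>F f = (\<psi>/a)(f) \<nabla>f + \<psi>(f) W\<close>, and as a homothetic field has constant divergence, the divergence of
  this is again a function of \<open>f\<close>.
\<close>

section \<open>Positive definite matrices and ellipsoids\<close>

text \<open>At a single point, a factorization \<open>h = transpose B ** B\<close> turns
  \<open>h\<close> into the standard inner product, \<open>W\<close> into the vector
  \<open>b = B *v W\<close>, and a covector into the vector \<open>e\<close> with
  \<open>df = transpose B *v e\<close>. All of the Finsler geometry at a point thus takes place in
  an abstract inner product space with one vector \<open>b\<close> of norm less than 1. The obstacle
  is that \<open>B\<close> is chosen at each point separately, so nothing is known about its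
  dependence on the point, and that \<open>gradient\<close> is the inverse of a map, given without
  any regularity. The results are therefore restated without \<open>B\<close>, in terms of a
  solution \<open>g\<close> of \<open>h g = df\<close>. Cramer's rule supplies such a solution as a
  quotient of determinants, which can be differentiated. The divergence stays a function of
  \<open>f\<close> because every coefficient in the gradient is one: differentiating a coefficient
  produces \<open>df\<close> applied to the gradient of \<open>h\<close> or to \<open>W\<close>,
  that is, the square of \<open>a(f)\<close> or \<phi>(f).\<close>

lemma mult_matrix_inv:
  fixes A :: "real^'n^'n"
  assumes "invertible A"
  shows "A ** matrix_inv A = mat 1" and "matrix_inv A ** A = mat 1"
  using assms unfolding invertible_def matrix_inv_def by (metis (mono_tags, lifting) someI_ex)+

text \<open>Every linear map is composed of singular maps, diagonal maps, coordinate swaps and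
  shears, and both the volume factor and the determinant are multiplicative.\<close>

lemma measure_matrix_image:
  fixes M :: "real^'n^'n"
  assumes "S \<in> lmeasurable"
  shows "measure lebesgue ((*v) M ` S) = \<bar>det M\<bar> * measure lebesgue S"
proof -
  \<comment> \<open>Measurability of images belongs to \<open>P\<close> because in the composition
    step \<open>P f\<close> is applied to an image under \<open>g\<close>.\<close>
  define P where "P f \<longleftrightarrow> (\<forall>S\<in>lmeasurable. f ` S \<in> lmeasurable \<and>
      measure lebesgue (f ` S) = \<bar>det (matrix f)\<bar> * measure lebesgue S)" for f :: "real^'n \<Rightarrow> real^'n"
  have "P ((*v) M)"
  proof (rule induct_linear_elementary [where P = P])
    fix f g :: "real^'n \<Rightarrow> real^'n"
    assume "linear f" "linear g" "P f" "P g"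
    then show "P (f \<circ> g)"
      unfolding P_def image_comp [symmetric] by (simp add: matrix_compose det_mul abs_mult)
  next
    fix f :: "real^'n \<Rightarrow> real^'n" and i
    assume f: "linear f" and 0: "\<And>x. f x $ i = 0"
    \<comment> \<open>A map with a vanishing coordinate misses an axis vector, so it is singular:
      its images are null sets and its determinant is 0.\<close>
    have "f x \<noteq> axis i 1" for x
      using 0 [of x] by (auto simp: vec_eq_iff axis_def)
    then have "\<not> surj f"
      by (metis surjD)
    then have "\<not> inj f"
      using f linear_injective_imp_surjective by blast
    then have "negligible (f ` S)" "det (matrix f) = 0" for S
      using f negligible_linear_singular_image [of f S] det_nz_iff_inj [of f] by auto
    then show "P f"
      by (auto simp: P_def negligible_iff_measure)
  next
    fix c :: "'n \<Rightarrow> real"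
    have "det (matrix (\<lambda>x::real^'n. \<chi> i. c i * x $ i)) = prod c UNIV"
      by (subst det_diagonal) (auto simp: matrix_def axis_def)
    then show "P (\<lambda>x. \<chi> i. c i * x $ i)"
      by (simp add: P_def measurable_stretch measure_stretch)
  next
    fix m n :: 'n
    assume "m \<noteq> n"
    let ?t = "Transposition.transpose m n"
    let ?f = "\<lambda>x::real^'n. \<chi> i. x $ ?t i"
    have lin: "linear ?f"
      by (rule linearI) (simp_all add: vec_eq_iff)
    have "matrix ?f = (\<chi> i. mat 1 $ ?t i)"
      by (auto simp: matrix_def mat_def axis_def vec_eq_iff)
    then have det: "\<bar>det (matrix ?f)\<bar> = 1"
      using det_permute_rows [of ?t "mat 1 :: real^'n^'n"]
      by (simp add: permutes_swap_id abs_mult sign_def)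
    have box: "measure lebesgue (?f ` cbox a b) = measure lebesgue (cbox a b)" for a b
    proof (cases "cbox a b = {}")
      case False
      have inv: "?f (?f x) = x" for x
        by (simp add: vec_eq_iff)
      have mem: "?f x \<in> cbox (?f a) (?f b) \<longleftrightarrow> x \<in> cbox a b" for x
        unfolding mem_box_cart by (simp add: vec_lambda_beta) (metis transpose_involutory)
      have "?f ` cbox a b = cbox (?f a) (?f b)"
      proof (intro equalityI subsetI)
        fix y
        assume "y \<in> cbox (?f a) (?f b)"
        then have "?f y \<in> cbox a b"
          using mem [of "?f y"] unfolding inv by blast
        then show "y \<in> ?f ` cbox a b"
          by (rule image_eqI [where x = "?f y", rotated]) (rule inv [symmetric])
      qed (use mem in blast)
      moreover from this have "cbox (?f a) (?f b) \<noteq> {}"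
        using False by auto
      moreover have "(\<Prod>i\<in>UNIV. b $ ?t i - a $ ?t i) = (\<Prod>i\<in>UNIV. b $ i - a $ i)"
        using prod.permute [OF permutes_swap_id, of m UNIV n "\<lambda>i. b $ i - a $ i"] by (simp add: o_def)
      ultimately show ?thesis
        using False by (simp add: content_cbox_cart)
    qed simp
    \<comment> \<open>A linear map that scales the volume of every box by \<open>m\<close> does so
      for every measurable set; a swap and a shear have \<open>m = 1\<close>.\<close>
    note im = measure_linear_sufficient [where m = 1, unfolded mult_1, OF lin _ box]
    show "P ?f"
      unfolding P_def det abs_one mult_1
      by (intro ballI conjI) (erule im [THEN conjunct1], erule im [THEN conjunct2, symmetric])
  next
    fix m n :: 'n
    assume mn: "m \<noteq> n"
    let ?f = "\<lambda>x::real^'n. \<chi> i. if i = m then x $ m + x $ n else x $ i"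
    have lin: "linear ?f"
      by (rule linearI) (auto simp: vec_eq_iff algebra_simps)
    have "matrix ?f = (\<chi> k. if k = m then row m (mat 1) + 1 *s row n (mat 1) else row k (mat 1))"
      by (auto simp: matrix_def mat_def axis_def row_def vec_eq_iff)
    then have det: "det (matrix ?f) = 1"
      using det_row_operation [OF mn, of "mat 1 :: real^'n^'n" 1] by simp
    have box: "measure lebesgue (?f ` cbox a b) = measure lebesgue (cbox a b)" for a b
    proof (cases "cbox a b = {}")
      case False
      \<comment> \<open>The volume formula for sheared boxes asks for a lower corner that is
        nonnegative in coordinate \<open>n\<close>; translating the corner to the origin arranges
        this.\<close>
      have shift: "(+) a ` cbox 0 (b - a) = cbox a b"
        using cbox_translation [of a 0 "b - a"] by simp
      have *: "?f ` cbox a b = (+) (?f a) ` ?f ` cbox 0 (b - a)"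
        unfolding shift [symmetric] image_image linear_add [OF lin] ..
      have "measure lebesgue (?f ` cbox a b) = measure lebesgue (?f ` cbox 0 (b - a))"
        unfolding * by (rule measure_translation)
      also have "\<dots> = measure lebesgue (cbox 0 (b - a))"
      proof (rule measure_shear_interval [OF mn])
        show "cbox 0 (b - a) \<noteq> {}"
          using False shift by auto
      qed simp
      also have "\<dots> = measure lebesgue ((+) a ` cbox 0 (b - a))"
        by (rule measure_translation [symmetric])
      finally show ?thesis
        unfolding shift .
    qed simp
    note im = measure_linear_sufficient [where m = 1, unfolded mult_1, OF lin _ box]
    show "P ?f"
      unfolding P_def det abs_one mult_1
      by (intro ballI conjI) (erule im [THEN conjunct1], erule im [THEN conjunct2, symmetric])
  qed simp
  then show ?thesis
    using assms by (simp add: P_def)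
qed

lemma matrix_vector_inner_transpose:
  fixes B :: "real^'n^'m"
  shows "(B *v x) \<bullet> y = x \<bullet> (transpose B *v y)"
  by (metis dot_lmul_matrix vector_transpose_matrix inner_commute transpose_transpose)

text \<open>Gram-Schmidt for the inner product \<open>x \<bullet> M y\<close> yields a basis that is orthonormal for it; the matrix
  with these columns is the inverse of \<open>B\<close>.\<close>

lemma pos_def_eq_transpose_mult:
  fixes M :: "real^'n^'n"
  assumes sym: "transpose M = M" and pos: "\<And>y. y \<noteq> 0 \<Longrightarrow> 0 < y \<bullet> (M *v y)"
  obtains B :: "real^'n^'n" where "M = transpose B ** B" and "invertible B"
proof -
  define ip where "ip x y = x \<bullet> (M *v y)" for x y
  have ip_sym: "ip x y = ip y x" for x y
    using matrix_vector_inner_transpose [of M x y] by (simp add: ip_def sym inner_commute)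
  have ip_add: "ip (x + y) z = ip x z + ip y z" and ip_scale: "ip (c *\<^sub>R x) z = c * ip x z"
    and ip_diff: "ip (x - y) z = ip x z - ip y z" for x y z c
    by (simp_all add: ip_def inner_add_left inner_diff_left)
  have ip_sum: "ip (\<Sum>i\<in>I. g i) z = (\<Sum>i\<in>I. ip (g i) z)" for I :: "(real^'n) set" and g z
    by (simp add: ip_def inner_sum_left)
  define orth where "orth S \<longleftrightarrow> finite S \<and> (\<forall>x\<in>S. \<forall>y\<in>S. ip x y = of_bool (x = y))" for S
  \<comment> \<open>An orthonormal set with fewer than \<open>CARD('n)\<close> elements cannot span,
    so some vector outside its span has a nonzero component orthogonal to it, which is normalized
    and added.\<close>
  have "\<exists>S. orth S \<and> card S = k" if "k \<le> CARD('n)" for k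
    using that
  proof (induction k)
    case 0
    have "orth {}" "card ({} :: (real^'n) set) = 0" by (simp_all add: orth_def)
    then show ?case by blast
  next
    case (Suc k)
    then obtain S where S: "orth S" "card S = k" by auto
    have "span S \<noteq> UNIV"
    proof
      assume "span S = UNIV"
      then have "CARD('n) \<le> card S"
        using S dim_le_card [of UNIV S] by (simp add: orth_def)
      then show False using Suc S by simp
    qed
    then obtain v where v: "v \<notin> span S" by auto
    define u where "u = v - (\<Sum>s\<in>S. ip v s *\<^sub>R s)"
    have "(\<Sum>s\<in>S. ip v s *\<^sub>R s) \<in> span S"
      by (intro span_sum span_scale span_base)
    then have "u \<noteq> 0" using v by (auto simp: u_def)
    then have uu: "ip u u > 0" using pos by (simp add: ip_def)
    have us: "ip u s = 0" if "s \<in> S" for s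
    proof -
      have "(\<Sum>t\<in>S. ip v t * ip t s) = (\<Sum>t\<in>S. if t = s then ip v t else 0)"
        using S that by (intro sum.cong) (auto simp: orth_def)
      then show ?thesis
        using S that by (simp add: u_def ip_diff ip_sum ip_scale orth_def)
    qed
    define w where "w = (1 / sqrt (ip u u)) *\<^sub>R u"
    have ww: "ip w w = 1"
      using uu by (simp add: w_def ip_scale ip_sym [of u "_ *\<^sub>R u"] field_simps)
    have ws: "ip w s = 0" "ip s w = 0" if "s \<in> S" for s
      using us [OF that] ip_sym [of s w] by (simp_all add: w_def ip_scale)
    have "w \<notin> S" using ww ws by force
    then have "orth (insert w S)" "card (insert w S) = Suc k"
      using S ww ws by (auto simp: orth_def)
    then show ?case by blast
  qed
  then obtain S where S: "orth S" "card S = CARD('n)" by blast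
  then obtain e :: "'n \<Rightarrow> real^'n" where e: "bij_betw e UNIV S"
    using finite_same_card_bij [of "UNIV :: 'n set" S] by (auto simp: orth_def)
  \<comment> \<open>Its columns are the orthonormal basis, so \<open>transpose P ** M ** P\<close>
    is the Gram matrix of that basis, the identity.\<close>
  define P :: "real^'n^'n" where "P = (\<chi> i j. e j $ i)"
  have col: "P *v axis j 1 = e j" for j
    by (simp add: P_def matrix_vector_mult_basis column_def vec_eq_iff)
  have "(transpose P ** M ** P) $ i $ j = (mat 1 :: real^'n^'n) $ i $ j" for i j
  proof -
    have "(transpose P ** M ** P) $ i $ j = axis i 1 \<bullet> ((transpose P ** M ** P) *v axis j 1)"
      by (simp add: inner_axis' matrix_vector_mult_basis column_def)
    also have "\<dots> = axis i 1 \<bullet> (transpose P *v (M *v e j))"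
      by (simp add: col matrix_vector_mul_assoc [symmetric])
    also have "\<dots> = ip (e i) (e j)"
      by (simp only: ip_def matrix_vector_inner_transpose [symmetric] col)
    also have "\<dots> = of_bool (e i = e j)"
      using S bij_betwE [OF e] by (simp add: orth_def)
    also have "\<dots> = (mat 1 :: real^'n^'n) $ i $ j"
      using e by (auto simp: mat_def bij_betw_def inj_eq)
    finally show ?thesis .
  qed
  then have PMP: "transpose P ** M ** P = mat 1"
    by (simp add: vec_eq_iff)
  then have P: "invertible P"
    using invertible_left_inverse by blast
  define B where "B = matrix_inv P"
  have PB: "P ** B = mat 1" and BP: "B ** P = mat 1"
    using P by (simp_all add: B_def mult_matrix_inv)
  have "transpose B ** transpose P = mat 1"
    using PB by (metis matrix_transpose_mul transpose_mat)
  then have "M = (transpose B ** transpose P) ** M ** (P ** B)"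
    by (simp add: PB)
  also have "\<dots> = transpose B ** (transpose P ** M ** P) ** B"
    by (simp add: matrix_mul_assoc)
  finally have "M = transpose B ** B"
    by (simp add: PMP)
  moreover have "invertible B"
    using PB BP by (auto simp: invertible_def)
  ultimately show thesis using that by blast
qed

text \<open>The set is the image of the unit ball under \<open>matrix_inv B\<close>, translated by
  \<open>w\<close>. For a factor \<open>B\<close> of the metric, the number by which the volume is
  divided is the Riemannian density.\<close>

lemma measure_ellipsoid:
  fixes B :: "real^'n^'n"
  assumes "invertible B"
  shows "measure lborel {y. norm (B *v (y - w)) < 1} = measure lborel (ball (0 :: real^'n) 1) / \<bar>det B\<bar>"
proof -
  have inv: "matrix_inv B ** B = mat 1" "B ** matrix_inv B = mat 1"
    using assms by (simp_all add: mult_matrix_inv)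
  then have det: "det (matrix_inv B) * det B = 1"
    by (metis det_mul det_I)
  then have "det B \<noteq> 0" by auto
  have "{y. norm (B *v (y - w)) < 1} = (+) w ` ((*v) (matrix_inv B) ` ball 0 1)"
  proof -
    have c: "B *v (matrix_inv B *v z) = z" "matrix_inv B *v (B *v z) = z" for z
      by (simp_all add: matrix_vector_mul_assoc inv)
    have "y = w + matrix_inv B *v (B *v (y - w))" for y
      by (simp only: c) simp
    moreover have "B *v ((w + matrix_inv B *v z) - w) = z" for z
      by (simp only: add_diff_cancel_left' c)
    ultimately show ?thesis
      unfolding image_image set_eq_iff image_iff mem_Collect_eq mem_ball_0 Bex_def by metis
  qed
  moreover have "measure lebesgue ((+) w ` ((*v) (matrix_inv B) ` ball 0 1))
      = \<bar>det (matrix_inv B)\<bar> * measure lebesgue (ball (0 :: real^'n) 1)"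
    by (subst measure_translation) (simp add: measure_matrix_image)
  moreover have "\<bar>det (matrix_inv B)\<bar> = 1 / \<bar>det B\<bar>"
    using det \<open>det B \<noteq> 0\<close> by (simp add: field_simps abs_mult [symmetric])
  \<comment> \<open>An open set is Borel, so its Lebesgue measure, computed above, is also its
    measure with respect to \<open>lborel\<close>.\<close>
  moreover have "open {y. norm (B *v (y - w)) < 1}"
    by (intro open_Collect_less continuous_intros linear_continuous_on_compose [where f = "\<lambda>x. x - w"] matrix_vector_mul_linear)
  ultimately show ?thesis
    by (simp add: measure_completion)
qed

section \<open>Randers norms\<close>

context
  fixes b :: "'v::real_inner"
  assumes b: "norm b < 1"
begin

abbreviation rlam :: real where "rlam \<equiv> 1 - (norm b)\<^sup>2"

definition rroot :: "'v \<Rightarrow> real" where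
  "rroot u = sqrt (rlam * (norm u)\<^sup>2 + (b \<bullet> u)\<^sup>2)"

text \<open>The formula for \<open>F\<close>, with \<open>h\<close> the inner product and
  \<open>b\<close> in the place of \<open>W\<close>. For \<open>u \<noteq> 0\<close> it is the
  positive root \<open>r\<close> of the quadratic equation that expresses
  \<open>norm (u - r *\<^sub>R b) = r\<close>, and \<open>rroot\<close> is the square root in the
  solution formula.\<close>

definition rnorm :: "'v \<Rightarrow> real" where
  "rnorm u = (rroot u - b \<bullet> u) / rlam"

lemma rlam_pos: "rlam > 0"
  using b by (simp add: power_less_one_iff)

lemma rroot_sq: "(rroot u)\<^sup>2 = rlam * (norm u)\<^sup>2 + (b \<bullet> u)\<^sup>2"
  unfolding rroot_def using rlam_pos by (intro real_sqrt_pow2) simp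

lemma rroot_pos: "u \<noteq> 0 \<Longrightarrow> rroot u > 0"
  unfolding rroot_def using mult_pos_pos [OF rlam_pos, of "(norm u)\<^sup>2"] by (simp add: add_pos_nonneg)

lemma rroot_nonneg: "rroot u \<ge> 0"
  unfolding rroot_def using rlam_pos
  by (intro real_sqrt_ge_zero add_nonneg_nonneg mult_nonneg_nonneg) auto

lemma rroot_eq: "rroot u = rlam * rnorm u + b \<bullet> u"
  using rlam_pos by (simp add: rnorm_def)

text \<open>Split so that \<open>norm (u - r *\<^sub>R b) = r\<close>, once squared, says that the
  terms after \<open>r\<^sup>2\<close> add up to 0; this is the quadratic equation for
  \<open>r\<close>.\<close>

lemma norm_diff_rnorm_sq: "(norm (u - r *\<^sub>R b))\<^sup>2 = r\<^sup>2 + (norm u)\<^sup>2 - 2 * r * (b \<bullet> u) - rlam * r\<^sup>2"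
  unfolding power2_norm_eq_inner by (simp add: algebra_simps inner_commute power2_eq_square)

lemma rnorm_quadratic: "(norm u)\<^sup>2 - 2 * rnorm u * (b \<bullet> u) - rlam * (rnorm u)\<^sup>2 = 0"
proof -
  have "rlam * ((norm u)\<^sup>2 - 2 * rnorm u * (b \<bullet> u) - rlam * (rnorm u)\<^sup>2)
      = rlam * (norm u)\<^sup>2 + (b \<bullet> u)\<^sup>2 - (rlam * rnorm u + b \<bullet> u)\<^sup>2"
    by (simp add: algebra_simps power2_eq_square)
  also have "\<dots> = 0"
    by (simp add: rroot_eq [symmetric] rroot_sq)
  finally show ?thesis
    using rlam_pos by simp
qed

lemma rnorm_pos:
  assumes "u \<noteq> 0" shows "rnorm u > 0"
proof -
  have "(b \<bullet> u)\<^sup>2 < (rroot u)\<^sup>2"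
    using assms rlam_pos by (simp add: rroot_sq)
  then have "b \<bullet> u < rroot u"
    using rroot_nonneg by (metis power2_less_imp_less)
  then show ?thesis
    using rlam_pos by (simp add: rnorm_def)
qed

text \<open>Zermelo's navigation: in time \<open>rnorm u\<close>, motion at unit speed together with
  the drift \<open>b\<close> covers exactly \<open>u\<close>.\<close>

lemma norm_diff_rnorm: "norm (u - rnorm u *\<^sub>R b) = rnorm u"
proof -
  have "(norm (u - rnorm u *\<^sub>R b))\<^sup>2 = (rnorm u)\<^sup>2"
    using rnorm_quadratic [of u] unfolding norm_diff_rnorm_sq by simp
  moreover have "rnorm u \<ge> 0"
    by (cases "u = 0") (simp_all add: rnorm_def rroot_def less_imp_le [OF rnorm_pos, unfolded rnorm_def rroot_def])
  ultimately show ?thesis by simp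
qed

text \<open>The first assumption makes \<open>r\<close> a root of the quadratic, so
  \<open>rlam * r + b \<bullet> u\<close> is plus or minus \<open>rroot u\<close>; the second
  assumption selects the sign.\<close>

lemma rnorm_eqI:
  assumes "norm (u - r *\<^sub>R b) = r" and "rlam * r + b \<bullet> u \<ge> 0"
  shows "rnorm u = r" and "rroot u = rlam * r + b \<bullet> u"
proof -
  have "rlam * (norm u)\<^sup>2 + (b \<bullet> u)\<^sup>2 = (rlam * r + b \<bullet> u)\<^sup>2 + rlam * ((norm u)\<^sup>2 - 2 * r * (b \<bullet> u) - rlam * r\<^sup>2)"
    by (simp add: algebra_simps power2_eq_square)
  also have "(norm u)\<^sup>2 - 2 * r * (b \<bullet> u) - rlam * r\<^sup>2 = 0"
    using norm_diff_rnorm_sq [of u r] assms(1) by simp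
  finally show *: "rroot u = rlam * r + b \<bullet> u"
    using assms(2) by (simp add: rroot_def)
  show "rnorm u = r"
    using rlam_pos unfolding rnorm_def * by simp
qed

lemma one_plus_inner_pos: "norm v \<le> 1 \<Longrightarrow> 1 + v \<bullet> b > 0"
  using Cauchy_Schwarz_ineq2 [of v b] b mult_left_le_one_le [of "norm b" "norm v"] by auto

text \<open>After clearing the denominator, squaring \<open>rroot u < rlam + b \<bullet> u\<close>
  leaves \<open>rlam\<close> times \<open>1 - (norm (u - b))\<^sup>2\<close>. The way back needs the
  right side to be positive; it equals \<open>1 + (u - b) \<bullet> b\<close>, which Cauchy-Schwarz
  controls on the shifted ball.\<close>

lemma rnorm_less_one_iff: "rnorm u < 1 \<longleftrightarrow> norm (u - b) < 1"
proof -
  have sq: "(rroot u)\<^sup>2 < (rlam + b \<bullet> u)\<^sup>2 \<longleftrightarrow> (norm (u - b))\<^sup>2 < 1"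
  proof -
    have "(rlam + b \<bullet> u)\<^sup>2 - (rroot u)\<^sup>2 = rlam * (1 - (norm (u - b))\<^sup>2)"
    proof -
      have "(norm (u - b))\<^sup>2 = (norm u)\<^sup>2 + (norm b)\<^sup>2 - 2 * (b \<bullet> u)"
        using norm_diff_rnorm_sq [of u 1] by simp
      then show ?thesis
        unfolding rroot_sq by (simp only:) (simp add: algebra_simps power2_eq_square)
    qed
    then have "(rroot u)\<^sup>2 < (rlam + b \<bullet> u)\<^sup>2 \<longleftrightarrow> 0 < rlam * (1 - (norm (u - b))\<^sup>2)"
      by linarith
    also have "\<dots> \<longleftrightarrow> (norm (u - b))\<^sup>2 < 1"
      by (subst zero_less_mult_iff) (use rlam_pos in linarith)
    finally show ?thesis .
  qed
  have pos: "rlam + b \<bullet> u > 0" if "norm (u - b) < 1"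
    using one_plus_inner_pos [of "u - b"] that
    by (simp add: inner_diff_left inner_diff_right power2_norm_eq_inner inner_commute)
  have "rnorm u < 1 \<longleftrightarrow> rroot u < rlam + b \<bullet> u"
    using rlam_pos by (simp add: rnorm_def field_simps)
  also have "\<dots> \<longleftrightarrow> norm (u - b) < 1"
  proof
    assume "rroot u < rlam + b \<bullet> u"
    then have "(rroot u)\<^sup>2 < (rlam + b \<bullet> u)\<^sup>2"
      using rroot_nonneg by (intro power_strict_mono) auto
    then show "norm (u - b) < 1"
      unfolding sq by (simp add: power_less_one_iff)
  next
    assume *: "norm (u - b) < 1"
    then have "(rroot u)\<^sup>2 < (rlam + b \<bullet> u)\<^sup>2"
      unfolding sq by (simp add: power_less_one_iff)
    then show "rroot u < rlam + b \<bullet> u"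
      using pos [OF *] by (metis less_imp_le power2_less_imp_less)
  qed
  finally show ?thesis .
qed

text \<open>The indicatrix is the unit sphere translated by \<open>b\<close>, so the dual norm of \<open>e\<close> is \<open>norm e + e \<bullet> b\<close>, attained at \<open>sgn e + b\<close>.\<close>

definition rleg :: "'v \<Rightarrow> 'v" where
  "rleg u = (rnorm u / rroot u) *\<^sub>R (u - rnorm u *\<^sub>R b)"

definition rgrad :: "'v \<Rightarrow> 'v" where
  "rgrad e = (norm e + e \<bullet> b) *\<^sub>R ((1 / norm e) *\<^sub>R e + b)"

text \<open>By \<open>norm_diff_rnorm\<close> the vector \<open>u - rnorm u *\<^sub>R b\<close> has
  norm \<open>rnorm u\<close>, so normalizing \<open>rleg u\<close> recovers
  \<open>u / rnorm u - b\<close>. The formula for \<open>rroot\<close> shows that the dual norm of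
  \<open>rleg u\<close> is \<open>rnorm u\<close>, and the two together rebuild
  \<open>u\<close>.\<close>

lemma rgrad_rleg:
  assumes "u \<noteq> 0"
  shows "rleg u \<noteq> 0" and "rgrad (rleg u) = u"
proof -
  let ?r = "rnorm u" and ?s = "rroot u"
  have r: "?r > 0" and s: "?s > 0"
    using assms rnorm_pos rroot_pos by auto
  have n: "norm (rleg u) = ?r\<^sup>2 / ?s"
    using r s by (simp add: rleg_def norm_diff_rnorm power2_eq_square)
  then show "rleg u \<noteq> 0"
    using r s by auto
  have "norm (rleg u) + rleg u \<bullet> b = (?r / ?s) * (?r + (u \<bullet> b - ?r * (norm b)\<^sup>2))"
    unfolding n power2_norm_eq_inner
    by (simp add: rleg_def inner_diff_left power2_eq_square distrib_left)
  also have "?r + (u \<bullet> b - ?r * (norm b)\<^sup>2) = ?s"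
    using rroot_eq [of u] by (simp add: algebra_simps inner_commute)
  also have "?r / ?s * ?s = ?r"
    using s by simp
  finally have "norm (rleg u) + rleg u \<bullet> b = ?r" .
  moreover have "(1 / norm (rleg u)) *\<^sub>R rleg u = (1 / ?r) *\<^sub>R (u - ?r *\<^sub>R b)"
    using r s unfolding n by (simp add: rleg_def power2_eq_square)
  ultimately show "rgrad (rleg u) = u"
    using r by (simp add: rgrad_def algebra_simps)
qed

text \<open>With \<open>r\<close> the dual norm of \<open>e\<close>, the vector
  \<open>rgrad e - r *\<^sub>R b\<close> is \<open>r\<close> times a unit vector, so
  \<open>rnorm_eqI\<close> identifies \<open>rnorm\<close> and \<open>rroot\<close> at
  \<open>rgrad e\<close>. Its sign condition is the positivity of \<open>1 + v \<bullet> b\<close>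
  for a unit vector \<open>v\<close>.\<close>

lemma rleg_rgrad:
  assumes "e \<noteq> 0"
  shows "rnorm (rgrad e) = norm e + e \<bullet> b" and "rgrad e \<noteq> 0" and "rleg (rgrad e) = e"
proof -
  define v where "v = (1 / norm e) *\<^sub>R e"
  define r where "r = norm e + e \<bullet> b"
  have v: "norm v = 1" "e = norm e *\<^sub>R v"
    using assms by (simp_all add: v_def)
  have p: "1 + v \<bullet> b > 0"
    using v one_plus_inner_pos by simp
  have re: "r = norm e * (1 + v \<bullet> b)"
    by (subst r_def, subst (2) v(2)) (simp add: algebra_simps)
  then have r: "r > 0"
    using assms p by simp
  have g: "rgrad e = r *\<^sub>R (v + b)"
    by (simp add: rgrad_def r_def v_def)
  have "norm (rgrad e - r *\<^sub>R b) = r"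
    using r v by (simp add: g algebra_simps)
  moreover have s: "rlam * r + b \<bullet> rgrad e = r * (1 + v \<bullet> b)"
    by (simp add: g power2_norm_eq_inner inner_add_right algebra_simps inner_commute)
  ultimately have *: "rnorm (rgrad e) = r" "rroot (rgrad e) = r * (1 + v \<bullet> b)"
    using rnorm_eqI [of "rgrad e" r] r p by simp_all
  then show "rnorm (rgrad e) = norm e + e \<bullet> b"
    by (simp add: r_def)
  show "rgrad e \<noteq> 0"
    using * r by (auto simp: rnorm_def rroot_def)
  have "rleg (rgrad e) = (r / (1 + v \<bullet> b)) *\<^sub>R v"
    unfolding rleg_def * using r p by (simp add: g scaleR_add_right)
  also have "\<dots> = e"
    using p v by (simp add: re)
  finally show "rleg (rgrad e) = e" .
qed

end

section \<open>The Randers metric and its gradient at one point of a chart\<close>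

lemma riem_norm_eq: "riem_norm h c x y = sqrt (y \<bullet> (h c x *v y))"
  unfolding riem_norm_def
  by (simp add: inner_vec_def matrix_vector_mult_def sum_distrib_left mult_ac)

lemma lower_eq: "lower h W c x = h c x *v W c x"
  by (simp add: lower_def matrix_vector_mult_def)

context
  fixes h :: "('a, 'n::finite) metric_field" and W c x B
  assumes hB: "h c x = transpose B ** B" and B: "invertible (B :: real^'n^'n)"
    and W: "riem_norm h c x (W c x) < 1"
begin

lemma factor_inner: "y \<bullet> (h c x *v z) = (B *v y) \<bullet> (B *v z)"
  by (simp only: hB matrix_vector_mul_assoc [symmetric] matrix_vector_inner_transpose)

lemma factor_norm: "riem_norm h c x y = norm (B *v y)"
  by (simp add: riem_norm_eq factor_inner norm_eq_sqrt_inner)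

lemma factor_W: "norm (B *v W c x) < 1"
  using W by (simp add: factor_norm)

lemma factor_inverse: "matrix_inv B *v (B *v y) = y" "B *v (matrix_inv B *v y) = y"
  using B by (simp_all add: matrix_vector_mul_assoc mult_matrix_inv)

lemma factor_eq_0: "B *v y = 0 \<longleftrightarrow> y = 0"
  using factor_inverse(1) [of y] by auto

lemma transpose_factor_inverse:
  "transpose B *v (transpose (matrix_inv B) *v e) = e" "transpose (matrix_inv B) *v (transpose B *v e) = e"
  using B by (simp_all only: matrix_vector_mul_assoc matrix_transpose_mul [symmetric] mult_matrix_inv
      transpose_mat matrix_vector_mul_lid)

lemma randers_factor: "randers h W c x y = rnorm (B *v W c x) (B *v y)"
proof -
  have "(\<Sum>i\<in>UNIV. lower h W c x $ i * y $ i) = (B *v W c x) \<bullet> (B *v y)"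
  proof -
    have "(\<Sum>i\<in>UNIV. lower h W c x $ i * y $ i) = y \<bullet> (h c x *v W c x)"
      by (simp add: lower_eq inner_vec_def mult.commute)
    then show ?thesis
      by (simp only: factor_inner inner_commute)
  qed
  then show ?thesis
    by (simp add: randers_def rnorm_def [OF factor_W] rroot_def [OF factor_W] factor_norm Let_def)
qed

lemma BH_density_randers: "BH_density (randers h W) c x = riem_density h c x"
proof -
  have "{y. randers h W c x y < 1} = {y. norm (B *v (y - W c x)) < 1}"
    by (simp add: randers_factor rnorm_less_one_iff [OF factor_W] matrix_vector_mult_diff_distrib)
  moreover have "\<bar>det B\<bar> = riem_density h c x"
    by (simp add: riem_density_def hB det_mul real_sqrt_mult)
  moreover have "measure lborel (ball (0::real^'n) 1) \<noteq> 0"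
    using content_ball_pos [of 1 "0::real^'n"] by simp
  ultimately show ?thesis
    by (simp add: BH_density_def measure_ellipsoid [OF B])
qed

text \<open>The chain rule: the derivative of \<open>rnorm b\<close> at \<open>B *v y\<close> is the
  inner product with a vector, and \<open>transpose B\<close> carries this vector to the covector in
  coordinates.\<close>

lemma legendre_randers:
  "legendre (randers h W) c x y = (if y = 0 then 0 else transpose B *v rleg (B *v W c x) (B *v y))"
proof (cases "y = 0")
  case False
  define b where "b = B *v W c x"
  have b: "norm b < 1" using factor_W by (simp add: b_def)
  let ?r = "rnorm b (B *v y)" and ?s = "rroot b (B *v y)" and ?l = "1 - (norm b)\<^sup>2"
  have l: "?l > 0" by (rule rlam_pos [OF b])
  have s: "?s > 0" using False rroot_pos [OF b] factor_eq_0 by simp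
  have lin: "bounded_linear ((*v) B)" by simp
  have s_eq: "sqrt (?l * ((B *v y) \<bullet> (B *v y)) + (b \<bullet> (B *v y))\<^sup>2) = ?s"
    by (simp add: rroot_def [OF b] power2_norm_eq_inner)
  have "((\<lambda>y. ?l * ((B *v y) \<bullet> (B *v y)) + (b \<bullet> (B *v y))\<^sup>2) has_derivative
      (\<lambda>v. ?l * (2 * ((B *v y) \<bullet> (B *v v))) + 2 * (b \<bullet> (B *v y)) * (b \<bullet> (B *v v)))) (at y)"
    by (auto intro!: derivative_eq_intros bounded_linear.has_derivative [OF lin]
        simp: fun_eq_iff inner_commute algebra_simps)
  from has_derivative_real_sqrt [OF _ this]
  have "((\<lambda>y. sqrt (?l * ((B *v y) \<bullet> (B *v y)) + (b \<bullet> (B *v y))\<^sup>2)) has_derivative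
      (\<lambda>v. (?l * (2 * ((B *v y) \<bullet> (B *v v))) + 2 * (b \<bullet> (B *v y)) * (b \<bullet> (B *v v))) / (2 * ?s))) (at y)"
    using s unfolding s_eq [symmetric] by (simp add: field_simps)
  then have "((\<lambda>y. (sqrt (?l * ((B *v y) \<bullet> (B *v y)) + (b \<bullet> (B *v y))\<^sup>2) - b \<bullet> (B *v y)) / ?l) has_derivative
      (\<lambda>v. ((?l * (2 * ((B *v y) \<bullet> (B *v v))) + 2 * (b \<bullet> (B *v y)) * (b \<bullet> (B *v v))) / (2 * ?s) - b \<bullet> (B *v v)) / ?l)) (at y)"
    by (intro bounded_linear.has_derivative [OF bounded_linear_divide] has_derivative_diff
        bounded_linear.has_derivative [OF bounded_linear_inner_right] bounded_linear_imp_has_derivative [OF lin])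
  moreover have "randers h W c x = (\<lambda>y. (sqrt (?l * ((B *v y) \<bullet> (B *v y)) + (b \<bullet> (B *v y))\<^sup>2) - b \<bullet> (B *v y)) / ?l)"
    by (simp add: fun_eq_iff randers_factor b_def [symmetric] rnorm_def [OF b] rroot_def [OF b] power2_norm_eq_inner)
  ultimately have "frechet_derivative (randers h W c x) (at y) =
      (\<lambda>v. ((?l * (2 * ((B *v y) \<bullet> (B *v v))) + 2 * (b \<bullet> (B *v y)) * (b \<bullet> (B *v v))) / (2 * ?s) - b \<bullet> (B *v v)) / ?l)"
    by (simp only: frechet_derivative_at [symmetric])
  also have "\<dots> = (\<lambda>v. ((1 / ?s) *\<^sub>R (B *v y - ?r *\<^sub>R b)) \<bullet> (B *v v))"
  proof
    fix v
    \<comment> \<open>With this substitution the two terms containing \<open>?s\<close> times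
      \<open>b \<bullet> (B *v v)\<close> cancel, and with them the division by
      \<open>?l\<close>.\<close>
    have "b \<bullet> (B *v y) = ?s - ?l * ?r"
      using rroot_eq [OF b, of "B *v y"] by simp
    then show "((?l * (2 * ((B *v y) \<bullet> (B *v v))) + 2 * (b \<bullet> (B *v y)) * (b \<bullet> (B *v v))) / (2 * ?s) - b \<bullet> (B *v v)) / ?l
        = ((1 / ?s) *\<^sub>R (B *v y - ?r *\<^sub>R b)) \<bullet> (B *v v)"
      using s l by (simp only: inner_diff_left inner_scaleR_left) (simp add: field_simps)
  qed
  also have "\<dots> = (\<lambda>v. (transpose B *v ((1 / ?s) *\<^sub>R (B *v y - ?r *\<^sub>R b))) \<bullet> v)"
    by (simp only: matrix_vector_inner_transpose transpose_transpose)
  finally have "partial i (randers h W c x) y = (transpose B *v ((1 / ?s) *\<^sub>R (B *v y - ?r *\<^sub>R b))) $ i" for i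
    by (simp add: partial_def inner_axis)
  then have "legendre (randers h W) c x y = ?r *\<^sub>R (transpose B *v ((1 / ?s) *\<^sub>R (B *v y - ?r *\<^sub>R b)))"
    using False unfolding legendre_def vec_eq_iff
    by (simp only: if_False vec_lambda_beta vector_scaleR_component real_scaleR_def randers_factor b_def [symmetric] simp_thms)
  also have "\<dots> = transpose B *v rleg b (B *v y)"
    by (simp add: rleg_def [OF b] matrix_vector_mult_scaleR)
  finally show ?thesis
    using False by (simp add: b_def)
qed (simp add: legendre_def)

text \<open>\<open>inv\<close> returns a known preimage only once the map is injective. Away from 0
  the left inverse \<open>rgrad\<close> gives injectivity; the zero vector is handled apart because
  \<open>legendre\<close> is defined there by a separate clause. \<open>rleg_rgrad\<close> then
  supplies the preimage.\<close>

lemma gradient_randers_factor: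
  assumes "differential f c x = transpose B *v e" and "e \<noteq> 0"
  shows "B *v gradient (randers h W) f c x = rgrad (B *v W c x) e"
proof -
  have inj: "inj (legendre (randers h W) c x)"
  proof (rule injI)
    fix y z
    assume eq: "legendre (randers h W) c x y = legendre (randers h W) c x z"
    have nz: "transpose B *v rleg (B *v W c x) (B *v y) \<noteq> 0" if "y \<noteq> 0" for y
    proof
      assume "transpose B *v rleg (B *v W c x) (B *v y) = 0"
      then have "rleg (B *v W c x) (B *v y) = 0"
        by (metis transpose_factor_inverse(2) matrix_vector_mult_0_right)
      then show False
        using that rgrad_rleg(1) [OF factor_W] factor_eq_0 by blast
    qed
    show "y = z"
    proof (cases "y = 0 \<or> z = 0")
      case True
      then show ?thesis
        using eq nz [of y] nz [of z] unfolding legendre_randers by (auto split: if_split_asm)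
    next
      case False
      then have "transpose B *v rleg (B *v W c x) (B *v y) = transpose B *v rleg (B *v W c x) (B *v z)"
        using eq unfolding legendre_randers by simp
      from arg_cong [OF this, of "(*v) (transpose (matrix_inv B))"]
      have "rleg (B *v W c x) (B *v y) = rleg (B *v W c x) (B *v z)"
        unfolding transpose_factor_inverse .
      then have "rgrad (B *v W c x) (rleg (B *v W c x) (B *v y)) = rgrad (B *v W c x) (rleg (B *v W c x) (B *v z))"
        by simp
      then have "B *v y = B *v z"
        using False factor_eq_0 by (simp add: rgrad_rleg(2) [OF factor_W])
      from arg_cong [OF this, of "(*v) (matrix_inv B)"] show ?thesis
        unfolding factor_inverse .
    qed
  qed
  let ?y = "matrix_inv B *v rgrad (B *v W c x) e"
  have "B *v ?y = rgrad (B *v W c x) e"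
    by (rule factor_inverse)
  moreover from this have "?y \<noteq> 0"
    using rleg_rgrad(2) [OF factor_W assms(2)] factor_eq_0 [of ?y] by simp
  ultimately have "legendre (randers h W) c x ?y = differential f c x"
    using rleg_rgrad(3) [OF factor_W assms(2)] by (simp add: legendre_randers assms(1))
  then have "gradient (randers h W) f c x = ?y"
    unfolding gradient_def by (intro inv_f_eq [OF inj])
  then show ?thesis
    by (simp add: factor_inverse)
qed

text \<open>If \<open>h\<close> maps \<open>g\<close> to the differential, the latter is
  \<open>transpose B *v e\<close> for \<open>e = B *v g\<close>. Then \<open>norm e\<close> and the
  inner product of \<open>e\<close> with \<open>B *v W c x\<close> are \<open>n\<close> and
  \<open>m\<close>, in which \<open>B\<close> no longer occurs.\<close>

lemma gradient_randers_solution: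
  assumes "differential f c x \<noteq> 0" and "h c x *v g = differential f c x"
  defines "n \<equiv> sqrt (differential f c x \<bullet> g)" and "m \<equiv> differential f c x \<bullet> W c x"
  shows "n > 0" and "gradient (randers h W) f c x = (n + m) *\<^sub>R ((1 / n) *\<^sub>R g + W c x)"
    and "randers h W c x (gradient (randers h W) f c x) = n + m"
proof -
  have d: "differential f c x = transpose B *v (B *v g)"
    using assms(2) by (simp only: hB matrix_vector_mul_assoc)
  have g: "B *v g \<noteq> 0"
    using assms(1) d by auto
  have n: "n = norm (B *v g)"
    unfolding n_def norm_eq_sqrt_inner d by (simp only: matrix_vector_inner_transpose transpose_transpose)
  then show "n > 0" using g by simp
  have m: "m = (B *v g) \<bullet> (B *v W c x)"
    unfolding m_def d by (simp only: matrix_vector_inner_transpose transpose_transpose)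
  have *: "B *v gradient (randers h W) f c x = rgrad (B *v W c x) (B *v g)"
    by (rule gradient_randers_factor [OF d g])
  also have "\<dots> = B *v ((n + m) *\<^sub>R ((1 / n) *\<^sub>R g + W c x))"
    by (simp add: rgrad_def [OF factor_W] n m matrix_vector_mult_scaleR matrix_vector_right_distrib)
  finally have "B *v gradient (randers h W) f c x = B *v ((n + m) *\<^sub>R ((1 / n) *\<^sub>R g + W c x))" .
  from arg_cong [OF this, of "(*v) (matrix_inv B)"]
  show "gradient (randers h W) f c x = (n + m) *\<^sub>R ((1 / n) *\<^sub>R g + W c x)"
    unfolding factor_inverse .
  show "randers h W c x (gradient (randers h W) f c x) = n + m"
    unfolding randers_factor * using rleg_rgrad(1) [OF factor_W g] by (simp add: n m)
qed

end

context
  fixes h :: "('a, 'n::finite) metric_field" and W :: "('a, 'n) vec_field" and c x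
  assumes sym: "transpose (h c x) = h c x" and pos: "\<And>y. y \<noteq> 0 \<Longrightarrow> 0 < y \<bullet> (h c x *v y)"
begin

lemma BH_density_eq_riem_density:
  assumes "riem_norm h c x (W c x) < 1"
  shows "BH_density (randers h W) c x = riem_density h c x"
proof -
  obtain B :: "real^'n^'n" where B: "h c x = transpose B ** B" "invertible B"
    using pos_def_eq_transpose_mult [OF sym pos] by metis
  show ?thesis
    by (rule BH_density_randers [of h c x B W, OF B assms])
qed

lemma gradient_randers:
  assumes "riem_norm h c x (W c x) < 1"
    and "differential f c x \<noteq> 0" and "h c x *v g = differential f c x"
  defines "n \<equiv> sqrt (differential f c x \<bullet> g)" and "m \<equiv> differential f c x \<bullet> W c x"
  shows "n > 0" and "gradient (randers h W) f c x = (n + m) *\<^sub>R ((1 / n) *\<^sub>R g + W c x)"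
    and "randers h W c x (gradient (randers h W) f c x) = n + m"
proof -
  obtain B :: "real^'n^'n" where B: "h c x = transpose B ** B" "invertible B"
    using pos_def_eq_transpose_mult [OF sym pos] by metis
  show "n > 0" and "gradient (randers h W) f c x = (n + m) *\<^sub>R ((1 / n) *\<^sub>R g + W c x)"
    and "randers h W c x (gradient (randers h W) f c x) = n + m"
    unfolding n_def m_def by (rule gradient_randers_solution [of h c x B W, OF B assms(1-3)])+
qed

text \<open>The Randers computation for zero wind: there \<open>F\<close> reduces to the square root
  of \<open>(riem_norm h c x y)\<^sup>2\<close>, which is the norm itself by nonnegativity.\<close>

lemma gradient_riem:
  assumes "differential f c x \<noteq> 0" and "h c x *v g = differential f c x"
  shows "gradient (riem_norm h) f c x = g"
    and "riem_norm h c x (gradient (riem_norm h) f c x) = sqrt (differential f c x \<bullet> g)"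
proof -
  obtain B :: "real^'n^'n" where B: "h c x = transpose B ** B" "invertible B"
    using pos_def_eq_transpose_mult [OF sym pos] by metis
  have "riem_norm h c x y \<ge> 0" for y
    using pos [of y] by (cases "y = 0") (simp_all add: riem_norm_eq)
  then have eq: "riem_norm h c x = randers h (\<lambda>_ _. 0) c x"
    by (simp add: fun_eq_iff randers_def lower_def riem_norm_def [of _ _ _ 0])
  then have grad: "gradient (riem_norm h) f c x = gradient (randers h (\<lambda>_ _. 0)) f c x"
    unfolding gradient_def legendre_def [abs_def] by (simp only:)
  have 0: "riem_norm h c x ((\<lambda>_ _. 0) c x) < 1"
    by (simp add: riem_norm_def)
  show "gradient (riem_norm h) f c x = g"
    and "riem_norm h c x (gradient (riem_norm h) f c x) = sqrt (differential f c x \<bullet> g)"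
    using gradient_randers_solution [of h c x B "\<lambda>_ _. 0", OF B 0 assms]
    by (simp_all add: grad eq)
qed

end

section \<open>Coordinate calculus\<close>

lemma partial_eqI:
  assumes "(g has_derivative g') (at x)"
  shows "partial i g x = g' (axis i 1)"
  using frechet_derivative_at [OF assms] by (simp add: partial_def)

text \<open>Both functions have the same derivatives at \<open>x\<close>, possibly none, so the
  choice hidden in \<open>frechet_derivative\<close> is the same for both.\<close>

lemma partial_cong_open:
  assumes "open U" "x \<in> U" "\<And>z. z \<in> U \<Longrightarrow> g z = g' z"
  shows "partial i g x = partial i g' x"
proof -
  have "(g has_derivative D) (at x) \<longleftrightarrow> (g' has_derivative D) (at x)" for D
  proof
    show "(g has_derivative D) (at x) \<Longrightarrow> (g' has_derivative D) (at x)"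
      by (erule has_derivative_transform_within_open [where s = U]) (simp_all add: assms)
    show "(g' has_derivative D) (at x) \<Longrightarrow> (g has_derivative D) (at x)"
      by (erule has_derivative_transform_within_open [where s = U]) (simp_all add: assms)
  qed
  then show ?thesis
    by (simp add: partial_def frechet_derivative_def)
qed

lemma partial_add:
  "g differentiable (at x) \<Longrightarrow> g' differentiable (at x) \<Longrightarrow>
    partial i (\<lambda>z. g z + g' z) x = partial i g x + partial i g' x"
  using partial_eqI [OF has_derivative_add]
  by (simp add: partial_def frechet_derivative_works)

lemma partial_sum:
  fixes g :: "'k \<Rightarrow> real^'n \<Rightarrow> 'b::real_normed_vector"
  assumes "\<And>k. k \<in> K \<Longrightarrow> g k differentiable (at x)"
  shows "partial i (\<lambda>z. \<Sum>k\<in>K. g k z) x = (\<Sum>k\<in>K. partial i (g k) x)"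
  unfolding partial_def using assms
  by (subst frechet_derivative_at [symmetric, OF has_derivative_sum])
    (auto simp: frechet_derivative_works [symmetric])

lemma partial_mult:
  fixes g g' :: "real^'n \<Rightarrow> real"
  assumes "g differentiable (at x)" "g' differentiable (at x)"
  shows "partial i (\<lambda>z. g z * g' z) x = partial i g x * g' x + g x * partial i g' x"
proof -
  have "((\<lambda>z. g z * g' z) has_derivative
      (\<lambda>v. g x * frechet_derivative g' (at x) v + frechet_derivative g (at x) v * g' x)) (at x)"
    using assms by (intro has_derivative_mult) (simp_all add: frechet_derivative_works [symmetric])
  from partial_eqI [OF this] show ?thesis
    by (simp add: partial_def)
qed

lemma partial_compose_real:
  fixes g :: "real^'n \<Rightarrow> real" and u :: "real \<Rightarrow> real"
  assumes "g differentiable (at x)" "(u has_real_derivative u') (at (g x))"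
  shows "partial i (\<lambda>z. u (g z)) x = u' * partial i g x"
    and "(\<lambda>z. u (g z)) differentiable (at x)"
proof -
  have "((\<lambda>z. u (g z)) has_derivative (\<lambda>v. u' * frechet_derivative g (at x) v)) (at x)"
    using DERIV_compose_FDERIV [of u u' g x "frechet_derivative g (at x)" UNIV] assms
    by (simp add: frechet_derivative_works mult.commute)
  from partial_eqI [OF this] this
  show "partial i (\<lambda>z. u (g z)) x = u' * partial i g x" and "(\<lambda>z. u (g z)) differentiable (at x)"
    by (auto simp: partial_def differentiable_def)
qed

lemma partial_vec_nth:
  assumes "g differentiable (at x)"
  shows "partial i (\<lambda>z. g z $ k) x = partial i g x $ k"
    and "(\<lambda>z. g z $ k) differentiable (at x)"
proof -
  have "((\<lambda>z. g z $ k) has_derivative (\<lambda>v. frechet_derivative g (at x) v $ k)) (at x)"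
    using assms by (intro bounded_linear.has_derivative [OF bounded_linear_vec_nth])
      (simp add: frechet_derivative_works)
  from partial_eqI [OF this] this show "partial i (\<lambda>z. g z $ k) x = partial i g x $ k"
    and "(\<lambda>z. g z $ k) differentiable (at x)"
    by (auto simp: partial_def differentiable_def)
qed

lemma differentiable_vecI:
  fixes g :: "'v::real_normed_vector \<Rightarrow> real^'n"
  assumes "\<And>k. (\<lambda>z. g z $ k) differentiable (at x)"
  shows "g differentiable (at x)"
  by (subst differentiable_componentwise_within) (auto simp: Basis_vec_def inner_axis assms)

text \<open>The product rule in the Leibniz formula differentiates one row at a time.\<close>

lemma has_derivative_det:
  fixes M :: "'v::real_normed_vector \<Rightarrow> real^'n^'n"
  assumes "\<And>i j. ((\<lambda>z. M z $ i $ j) has_derivative (\<lambda>v. M' v $ i $ j)) (at x)"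
  shows "((\<lambda>z. det (M z)) has_derivative
    (\<lambda>v. \<Sum>i\<in>UNIV. det (\<chi> k. if k = i then M' v $ i else M x $ k))) (at x)"
proof -
  have "((\<lambda>z. det (M z)) has_derivative (\<lambda>v. \<Sum>p | p permutes UNIV. of_int (sign p) *
      (\<Sum>i\<in>UNIV. M' v $ i $ p i * (\<Prod>k\<in>UNIV - {i}. M x $ k $ p k)))) (at x)"
    unfolding det_def by (intro has_derivative_sum has_derivative_mult_right has_derivative_prod assms)
  moreover have "(\<Sum>p | p permutes UNIV. of_int (sign p) *
      (\<Sum>i\<in>UNIV. M' v $ i $ p i * (\<Prod>k\<in>UNIV - {i}. M x $ k $ p k)))
    = (\<Sum>i\<in>UNIV. det (\<chi> k. if k = i then M' v $ i else M x $ k))" for v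
  proof -
    have "(\<Prod>k\<in>UNIV. (\<chi> k. if k = i then M' v $ i else M x $ k) $ k $ p k)
        = M' v $ i $ p i * (\<Prod>k\<in>UNIV - {i}. M x $ k $ p k)" for i p
      by (subst prod.remove [of _ i]) (auto intro!: prod.cong)
    then show ?thesis
      unfolding det_def by (subst sum.swap) (simp add: sum_distrib_left)
  qed
  ultimately show ?thesis by simp
qed

lemma differentiable_det:
  fixes M :: "'v::real_normed_vector \<Rightarrow> real^'n^'n"
  assumes "\<And>i j. (\<lambda>z. M z $ i $ j) differentiable (at x)"
  shows "(\<lambda>z. det (M z)) differentiable (at x)"
proof -
  have "((\<lambda>z. M z $ i $ j) has_derivative
      (\<lambda>v. (\<chi> i j. frechet_derivative (\<lambda>z. M z $ i $ j) (at x) v) $ i $ j)) (at x)" for i j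
    using assms by (simp add: frechet_derivative_works)
  from has_derivative_det [OF this] show ?thesis
    by (auto simp: differentiable_def)
qed

text \<open>Jacobi's formula. Row \<open>i\<close> of the derivative \<open>D\<close> is a
  combination of the rows of \<open>M x\<close>, with coefficients from row \<open>i\<close> of
  \<open>D ** matrix_inv (M x)\<close>. Put in place of row \<open>i\<close> of \<open>M x\<close>,
  it contributes to the determinant only through its diagonal coefficient; the sum over
  \<open>i\<close> is a trace.\<close>

lemma partial_det:
  fixes M :: "real^'n \<Rightarrow> real^'n^'n"
  assumes M: "\<And>i j. (\<lambda>z. M z $ i $ j) differentiable (at x)" and inv: "invertible (M x)"
  shows "partial l (\<lambda>z. det (M z)) x =
    det (M x) * (\<Sum>i\<in>UNIV. \<Sum>j\<in>UNIV. matrix_inv (M x) $ j $ i * partial l (\<lambda>z. M z $ i $ j) x)"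
proof -
  define M' where "M' v = (\<chi> i j. frechet_derivative (\<lambda>z. M z $ i $ j) (at x) v)" for v
  define D where "D = M' (axis l 1)"
  have "((\<lambda>z. M z $ i $ j) has_derivative (\<lambda>v. M' v $ i $ j)) (at x)" for i j
    using M by (simp add: M'_def frechet_derivative_works)
  from partial_eqI [OF has_derivative_det [OF this]]
  have "partial l (\<lambda>z. det (M z)) x = (\<Sum>i\<in>UNIV. det (\<chi> k. if k = i then D $ i else M x $ k))"
    unfolding D_def .
  also have "\<dots> = (\<Sum>i\<in>UNIV. (D ** matrix_inv (M x)) $ i $ i * det (M x))"
  proof (rule sum.cong [OF refl])
    fix i
    have D_eq: "D = (D ** matrix_inv (M x)) ** M x"
      by (simp add: matrix_mul_assoc [symmetric] mult_matrix_inv inv)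
    have rows: "row k (M x) = M x $ k" for k
      by (simp add: row_def vec_eq_iff)
    have "D $ i = (\<Sum>k\<in>UNIV. (D ** matrix_inv (M x)) $ i $ k *s M x $ k)"
      by (subst D_eq) (simp add: vec_eq_iff matrix_matrix_mult_def)
    then show "det (\<chi> k. if k = i then D $ i else M x $ k) = (D ** matrix_inv (M x)) $ i $ i * det (M x)"
      using cramer_lemma_transpose [of i "(D ** matrix_inv (M x)) $ i" "M x"] by (simp only: rows)
  qed
  also have "\<dots> = det (M x) * (\<Sum>i\<in>UNIV. \<Sum>j\<in>UNIV. matrix_inv (M x) $ j $ i * D $ i $ j)"
    by (simp add: matrix_matrix_mult_def sum_distrib_left sum_distrib_right mult_ac)
  finally show ?thesis
    by (simp add: D_def M'_def partial_def)
qed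

text \<open>These are Cramer's quotients for the linear system with matrix \<open>M z\<close> and
  right side \<open>b z\<close>; numerators and denominator are polynomials in the entries.\<close>

lemma differentiable_solution:
  fixes M :: "'v::real_normed_vector \<Rightarrow> real^'n^'n" and b :: "'v \<Rightarrow> real^'n"
  assumes "\<And>i j. (\<lambda>z. M z $ i $ j) differentiable (at x)"
    and "\<And>i. (\<lambda>z. b z $ i) differentiable (at x)" and "det (M x) \<noteq> 0"
  shows "(\<lambda>z. (\<chi> k. det (\<chi> i j. if j = k then b z $ i else M z $ i $ j) / det (M z))) differentiable (at x)"
proof (rule differentiable_vecI)
  fix k
  have "(\<lambda>z. det (\<chi> i j. if j = k then b z $ i else M z $ i $ j)) differentiable (at x)"
    using assms(1,2) by (intro differentiable_det) (case_tac "j = k"; simp)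
  then show "(\<lambda>z. (\<chi> k. det (\<chi> i j. if j = k then b z $ i else M z $ i $ j) / det (M z)) $ k) differentiable (at x)"
    using differentiable_det [OF assms(1)] assms(3) by simp
qed

lemma divergence_cong_open:
  assumes "open U" "x \<in> U" "\<And>z. z \<in> U \<Longrightarrow> \<sigma> c z = \<sigma>' c z" "\<And>z. z \<in> U \<Longrightarrow> X c z = X' c z"
  shows "divergence \<sigma> X c x = divergence \<sigma>' X' c x"
proof -
  have "partial i (\<lambda>z. \<sigma> c z * X c z $ i) x = partial i (\<lambda>z. \<sigma>' c z * X' c z $ i) x" for i
    by (rule partial_cong_open [OF assms(1,2)]) (simp add: assms(3,4))
  then show ?thesis
    using assms by (simp add: divergence_def)
qed

lemma divergence_add:
  assumes "\<sigma> c differentiable (at x)" "X c differentiable (at x)" "Y c differentiable (at x)"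
  shows "divergence \<sigma> (\<lambda>c z. X c z + Y c z) c x = divergence \<sigma> X c x + divergence \<sigma> Y c x"
proof -
  have "partial i (\<lambda>z. \<sigma> c z * (X c z + Y c z) $ i) x =
      partial i (\<lambda>z. \<sigma> c z * X c z $ i) x + partial i (\<lambda>z. \<sigma> c z * Y c z $ i) x" for i
    using partial_add [OF differentiable_mult [OF assms(1) partial_vec_nth(2) [OF assms(2)]]
        differentiable_mult [OF assms(1) partial_vec_nth(2) [OF assms(3)]]]
    by (simp add: distrib_left)
  then show ?thesis
    by (simp add: divergence_def sum.distrib add_divide_distrib)
qed

lemma divergence_scale:
  assumes "\<sigma> c differentiable (at x)" "X c differentiable (at x)" "u c differentiable (at x)" "\<sigma> c x \<noteq> 0"
  shows "divergence \<sigma> (\<lambda>c z. u c z *\<^sub>R X c z) c x =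
    u c x * divergence \<sigma> X c x + (\<Sum>i\<in>UNIV. partial i (u c) x * X c x $ i)"
proof -
  have "partial i (\<lambda>z. \<sigma> c z * (u c z *\<^sub>R X c z) $ i) x =
      partial i (u c) x * (\<sigma> c x * X c x $ i) + u c x * partial i (\<lambda>z. \<sigma> c z * X c z $ i) x" for i
    using partial_mult [OF assms(3) differentiable_mult [OF assms(1) partial_vec_nth(2) [OF assms(2)]]]
    by (simp add: mult_ac)
  then show ?thesis
    using assms(4) unfolding divergence_def
    by (simp add: sum.distrib add_divide_distrib sum_distrib_left sum_divide_distrib)
qed

section \<open>Functions of class \<open>Ck_on\<close> and smooth functions\<close>

lemma Ck_on_imp_continuous_on: "Ck_on k S g \<Longrightarrow> continuous_on S g"
  by (cases k) (auto intro!: continuous_at_imp_continuous_on differentiable_imp_continuous_within)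

text \<open>On an open set the two-sided derivatives depend only on the values in the set, at every
  order.\<close>

lemma Ck_on_cong:
  fixes g g' :: "'v::euclidean_space \<Rightarrow> 'w::real_normed_vector"
  assumes S: "open S" and "\<And>x. x \<in> S \<Longrightarrow> g x = g' x" "Ck_on k S g"
  shows "Ck_on k S g'"
  using assms(2,3)
proof (induction k arbitrary: g g')
  case 0
  show ?case
    using 0(2,1) unfolding Ck_on.simps by (rule continuous_on_eq)
next
  case (Suc k)
  have D: "(g' has_derivative frechet_derivative g (at x)) (at x)" if "x \<in> S" for x
  proof (rule has_derivative_transform_within_open [OF _ S that])
    show "(g has_derivative frechet_derivative g (at x)) (at x)"
      using Suc.prems(2) that by (simp add: frechet_derivative_works [symmetric])
  qed (rule Suc.prems(1))
  have "Ck_on k S (\<lambda>x. frechet_derivative g' (at x) v)" for v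
  proof (rule Suc.IH)
    show "frechet_derivative g (at x) v = frechet_derivative g' (at x) v" if "x \<in> S" for x
      using frechet_derivative_at [OF D [OF that]] by simp
    show "Ck_on k S (\<lambda>x. frechet_derivative g (at x) v)"
      using Suc.prems by simp
  qed
  then show ?case
    using D by (auto simp: differentiable_def)
qed

text \<open>The scalar lets one induction serve both sums (\<open>r = 1\<close>) and differences
  (\<open>r = - 1\<close>).\<close>

lemma Ck_on_add_scaleR:
  fixes g g' :: "'v::euclidean_space \<Rightarrow> 'w::real_normed_vector"
  assumes S: "open S" and "Ck_on k S g" "Ck_on k S g'"
  shows "Ck_on k S (\<lambda>x. g x + r *\<^sub>R g' x)"
  using assms(2,3)
proof (induction k arbitrary: g g')
  case 0
  then show ?case by (auto intro!: continuous_intros)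
next
  case (Suc k)
  have D: "((\<lambda>x. g x + r *\<^sub>R g' x) has_derivative
      (\<lambda>v. frechet_derivative g (at x) v + r *\<^sub>R frechet_derivative g' (at x) v)) (at x)"
    if "x \<in> S" for x
    using Suc.prems that
    by (intro has_derivative_add has_derivative_scaleR_right) (auto simp: frechet_derivative_works [symmetric])
  have "Ck_on k S (\<lambda>x. frechet_derivative (\<lambda>x. g x + r *\<^sub>R g' x) (at x) v)" for v
  proof (rule Ck_on_cong [OF S])
    show "Ck_on k S (\<lambda>x. frechet_derivative g (at x) v + r *\<^sub>R frechet_derivative g' (at x) v)"
      using Suc by simp
  qed (simp add: frechet_derivative_at [OF D, symmetric])
  then show ?case
    using D by (auto simp: differentiable_def)
qed

lemma smooth_on_add:
  "open S \<Longrightarrow> smooth_on S g \<Longrightarrow> smooth_on S g' \<Longrightarrow> smooth_on S (\<lambda>x. g x + g' x)"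
  using Ck_on_add_scaleR [of S _ g g' 1] by (simp add: smooth_on_def)

lemma smooth_on_diff:
  "open S \<Longrightarrow> smooth_on S g \<Longrightarrow> smooth_on S g' \<Longrightarrow> smooth_on S (\<lambda>x. g x - g' x)"
  using Ck_on_add_scaleR [of S _ g g' "- 1"] by (simp add: smooth_on_def)

lemma Ck_on_1_differentiable: "Ck_on 1 S g \<Longrightarrow> x \<in> S \<Longrightarrow> g differentiable (at x)"
  by simp

lemma smooth_on_Ck_on: "smooth_on S g \<Longrightarrow> Ck_on k S g"
  by (simp add: smooth_on_def)

lemma smooth_on_differentiable: "smooth_on S g \<Longrightarrow> x \<in> S \<Longrightarrow> g differentiable (at x)"
  using smooth_on_Ck_on [of S g 1] by simp

lemma smooth_on_partial_differentiable:
  "smooth_on S g \<Longrightarrow> x \<in> S \<Longrightarrow> partial i g differentiable (at x)"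
  using smooth_on_Ck_on [of S g 2] by (simp add: partial_def [abs_def] numeral_2_eq_2)

text \<open>A linear map on the reals is multiplication by its value at 1. The continuity of
  \<open>u'\<close> later makes the Finsler-Laplacian a continuous function of
  \<open>f\<close>.\<close>

lemma smooth_on_real_derivative:
  fixes u :: "real \<Rightarrow> real"
  assumes "smooth_on S u"
  obtains u' where "continuous_on S u'" "\<And>t. t \<in> S \<Longrightarrow> (u has_real_derivative u' t) (at t)"
proof (rule that)
  show "continuous_on S (\<lambda>t. frechet_derivative u (at t) 1)"
    using smooth_on_Ck_on [OF assms, of 1] by simp
  show "(u has_real_derivative frechet_derivative u (at t) 1) (at t)" if "t \<in> S" for t
  proof -
    have D: "(u has_derivative frechet_derivative u (at t)) (at t)"
      using smooth_on_differentiable [OF assms that] by (simp add: frechet_derivative_works)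
    have "frechet_derivative u (at t) s = frechet_derivative u (at t) 1 * s" for s
      using linear_scale [OF has_derivative_linear [OF D], of s 1] by simp
    then have "frechet_derivative u (at t) = (*) (frechet_derivative u (at t) 1)"
      by (rule ext)
    with D show ?thesis
      unfolding has_field_derivative_def by metis
  qed
qed

section \<open>Algebra behind the trace of the covariant derivative\<close>

lemma det_pos_def:
  fixes M :: "real^'n^'n"
  assumes "transpose M = M" "\<And>y. y \<noteq> 0 \<Longrightarrow> 0 < y \<bullet> (M *v y)"
  shows "0 < det M"
proof -
  obtain B :: "real^'n^'n" where "M = transpose B ** B" "invertible B"
    using pos_def_eq_transpose_mult [OF assms] by metis
  then show ?thesis
    by (auto simp: det_mul invertible_det_nz zero_less_mult_iff)
qed

lemma sum_rotate:
  "(\<Sum>a\<in>A. \<Sum>b\<in>B. \<Sum>c\<in>C. g a b c) = (\<Sum>b\<in>B. \<Sum>c\<in>C. \<Sum>a\<in>A. g a b c)"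
proof -
  have "(\<Sum>a\<in>A. \<Sum>b\<in>B. \<Sum>c\<in>C. g a b c) = (\<Sum>b\<in>B. \<Sum>a\<in>A. \<Sum>c\<in>C. g a b c)"
    by (rule sum.swap)
  also have "\<dots> = (\<Sum>b\<in>B. \<Sum>c\<in>C. \<Sum>a\<in>A. g a b c)"
    by (intro sum.cong refl sum.swap)
  finally show ?thesis .
qed

text \<open>The index computation behind the equality of the trace of
  \<open>w\<^sub>i\<^sub>|\<^sub>j\<close> with the divergence of \<open>W\<close>. Here
  \<open>H\<close> stands for the metric and \<open>K\<close> for its inverse,
  \<open>dh l i j\<close> for the derivative of \<open>H i j\<close> in direction \<open>l\<close>,
  and \<open>dw j k\<close> for that of \<open>w k\<close> in direction \<open>j\<close>. The left
  side is the contracted covariant derivative of the lowered field; the last term on the right is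
  the logarithmic derivative of the volume density along \<open>w\<close>.\<close>

lemma metric_trace_identity:
  fixes K H :: "'n::finite \<Rightarrow> 'n \<Rightarrow> real"
  assumes sym: "\<And>i j. K i j = K j i"
    and inv: "\<And>l m. (\<Sum>k\<in>UNIV. K k l * H k m) = (if l = m then 1 else 0)"
  shows "(\<Sum>i\<in>UNIV. \<Sum>j\<in>UNIV. K i j * ((\<Sum>k\<in>UNIV. dh j i k * w k + H i k * dw j k)
      - (\<Sum>k\<in>UNIV. (\<Sum>l\<in>UNIV. K k l / 2 * (dh i j l + dh j i l - dh l i j)) * (\<Sum>m\<in>UNIV. H k m * w m))))
    = (\<Sum>j\<in>UNIV. dw j j) + (\<Sum>l\<in>UNIV. w l * (\<Sum>i\<in>UNIV. \<Sum>j\<in>UNIV. K i j * dh l i j)) / 2"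
proof -
  have 1: "(\<Sum>k\<in>UNIV. (\<Sum>l\<in>UNIV. K k l / 2 * T l) * (\<Sum>m\<in>UNIV. H k m * w m)) = (\<Sum>l\<in>UNIV. T l * w l) / 2"
    for T :: "'n \<Rightarrow> real"
  proof -
    have "(\<Sum>k\<in>UNIV. (\<Sum>l\<in>UNIV. K k l / 2 * T l) * (\<Sum>m\<in>UNIV. H k m * w m))
        = (\<Sum>k\<in>UNIV. \<Sum>l\<in>UNIV. \<Sum>m\<in>UNIV. T l * w m / 2 * (K k l * H k m))"
      unfolding sum_product by (simp add: mult_ac)
    also have "\<dots> = (\<Sum>l\<in>UNIV. \<Sum>m\<in>UNIV. \<Sum>k\<in>UNIV. T l * w m / 2 * (K k l * H k m))"
      by (rule sum_rotate)
    also have "\<dots> = (\<Sum>l\<in>UNIV. T l * w l) / 2"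
      unfolding sum_distrib_left [symmetric] inv
      by (simp add: sum_divide_distrib if_distrib [of "\<lambda>x. _ * x"] cong: if_cong)
    finally show ?thesis .
  qed
  have 2: "(\<Sum>i\<in>UNIV. \<Sum>j\<in>UNIV. K i j * (\<Sum>k\<in>UNIV. H i k * dw j k)) = (\<Sum>j\<in>UNIV. dw j j)"
  proof -
    have "(\<Sum>i\<in>UNIV. \<Sum>j\<in>UNIV. K i j * (\<Sum>k\<in>UNIV. H i k * dw j k))
        = (\<Sum>i\<in>UNIV. \<Sum>j\<in>UNIV. \<Sum>k\<in>UNIV. dw j k * (K i j * H i k))"
      by (simp add: sum_distrib_left mult_ac)
    also have "\<dots> = (\<Sum>j\<in>UNIV. \<Sum>k\<in>UNIV. \<Sum>i\<in>UNIV. dw j k * (K i j * H i k))"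
      by (rule sum_rotate)
    also have "\<dots> = (\<Sum>j\<in>UNIV. dw j j)"
      unfolding sum_distrib_left [symmetric] inv
      by (simp add: if_distrib [of "\<lambda>x. _ * x"] cong: if_cong)
    finally show ?thesis .
  qed
  \<comment> \<open>The derivative of the lowered field contributes one copy of the second sum, and
    the Christoffel symbols subtract half of each. By this equality these terms cancel, and only the
    half with \<open>dh l i j\<close> survives.\<close>
  have 3: "(\<Sum>i\<in>UNIV. \<Sum>j\<in>UNIV. K i j * (\<Sum>l\<in>UNIV. dh i j l * w l))
      = (\<Sum>i\<in>UNIV. \<Sum>j\<in>UNIV. K i j * (\<Sum>l\<in>UNIV. dh j i l * w l))"
    by (subst sum.swap) (simp add: sym)
  have 4: "(\<Sum>l\<in>UNIV. w l * (\<Sum>i\<in>UNIV. \<Sum>j\<in>UNIV. K i j * dh l i j))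
      = (\<Sum>i\<in>UNIV. \<Sum>j\<in>UNIV. K i j * (\<Sum>l\<in>UNIV. dh l i j * w l))"
  proof -
    have "(\<Sum>l\<in>UNIV. w l * (\<Sum>i\<in>UNIV. \<Sum>j\<in>UNIV. K i j * dh l i j))
        = (\<Sum>l\<in>UNIV. \<Sum>i\<in>UNIV. \<Sum>j\<in>UNIV. K i j * (dh l i j * w l))"
      by (simp add: sum_distrib_left mult_ac)
    also have "\<dots> = (\<Sum>i\<in>UNIV. \<Sum>j\<in>UNIV. \<Sum>l\<in>UNIV. K i j * (dh l i j * w l))"
      by (rule sum_rotate)
    finally show ?thesis
      by (simp add: sum_distrib_left)
  qed
  have "K i j * ((\<Sum>k\<in>UNIV. dh j i k * w k + H i k * dw j k)
      - (\<Sum>l\<in>UNIV. (dh i j l + dh j i l - dh l i j) * w l) / 2)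
    = K i j * (\<Sum>k\<in>UNIV. H i k * dw j k) + K i j * (\<Sum>l\<in>UNIV. dh j i l * w l) / 2
      - K i j * (\<Sum>l\<in>UNIV. dh i j l * w l) / 2 + K i j * (\<Sum>l\<in>UNIV. dh l i j * w l) / 2" for i j
    by (simp add: sum.distrib sum_subtractf algebra_simps add_divide_distrib diff_divide_distrib)
  then show ?thesis
    unfolding 1 4 by (simp add: sum.distrib sum_subtractf sum_divide_distrib [symmetric] 2 3)
qed

section \<open>Charts and regular values\<close>

lemma frechet_derivative_eq_inner_partial:
  fixes g :: "real^'n \<Rightarrow> real"
  assumes "g differentiable (at x)"
  shows "frechet_derivative g (at x) v = (\<chi> i. partial i g x) \<bullet> v"
proof -
  have L: "linear (frechet_derivative g (at x))"
    using assms by (simp add: linear_frechet_derivative)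
  have "frechet_derivative g (at x) (\<Sum>i\<in>UNIV. v $ i *\<^sub>R axis i 1)
      = (\<Sum>i\<in>UNIV. v $ i * frechet_derivative g (at x) (axis i 1))"
    by (simp add: linear_sum [OF L] linear_scale [OF L])
  moreover have "(\<Sum>i\<in>UNIV. v $ i *\<^sub>R axis i 1) = v"
    using basis_expansion [of v] by (simp add: scalar_mult_eq_scaleR)
  ultimately show ?thesis
    by (simp add: inner_vec_def partial_def mult.commute)
qed

text \<open>On the line through \<open>x\<close> in the direction of the Euclidean gradient
  \<open>v\<close>, the derivative of \<open>g\<close> is \<open>v \<bullet> v > 0\<close>. So
  \<open>g\<close> takes values on both sides of \<open>g x\<close> there, and the intermediate
  value theorem fills an interval.\<close>

lemma open_image_regular:
  fixes g :: "real^'n \<Rightarrow> real"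
  assumes "open S" and diff: "\<And>x. x \<in> S \<Longrightarrow> g differentiable (at x)"
    and nz: "\<And>x. x \<in> S \<Longrightarrow> (\<chi> i. partial i g x) \<noteq> 0"
  shows "open (g ` S)"
proof (subst open_subopen, safe)
  fix x assume x: "x \<in> S"
  define v where "v = (\<chi> i. partial i g x)"
  define q where "q t = g (x + t *\<^sub>R v)" for t :: real
  obtain e where e: "e > 0" "ball x e \<subseteq> S"
    using \<open>open S\<close> x openE by blast
  have v: "norm v > 0" using nz [OF x] by (simp add: v_def)
  have "((\<lambda>t. x + t *\<^sub>R v) has_derivative (\<lambda>t. t *\<^sub>R v)) (at 0)"
    by (auto intro!: derivative_eq_intros)
  moreover have "(g has_derivative (\<lambda>w. v \<bullet> w)) (at (x + 0 *\<^sub>R v))"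
  proof -
    have "frechet_derivative g (at x) = (\<lambda>w. v \<bullet> w)"
      using frechet_derivative_eq_inner_partial [OF diff [OF x]] by (simp add: fun_eq_iff v_def)
    then show ?thesis
      using diff [OF x] by (simp add: frechet_derivative_works)
  qed
  ultimately have "(q has_derivative (\<lambda>t. v \<bullet> (t *\<^sub>R v))) (at 0)"
    unfolding q_def by (rule has_derivative_compose)
  then have D: "(q has_real_derivative v \<bullet> v) (at 0)"
    unfolding has_field_derivative_def by (simp add: mult.commute [of "v \<bullet> v", abs_def])
  have vv: "v \<bullet> v > 0" using v by simp
  obtain r where r: "r > 0" "\<And>t. 0 < t \<Longrightarrow> t < r \<Longrightarrow> q 0 < q t"
    using DERIV_pos_inc_right [OF D vv] by auto
  obtain l where l: "l > 0" "\<And>t. 0 < t \<Longrightarrow> t < l \<Longrightarrow> q (- t) < q 0"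
    using DERIV_pos_inc_left [OF D vv] by auto
  \<comment> \<open>Below \<open>r\<close> and \<open>l\<close> the comparison with
    \<open>q 0\<close> holds on both sides, and below \<open>e / norm v\<close> the segment stays in
    the ball inside \<open>S\<close>.\<close>
  have "min (min r l) (e / norm v) > 0"
    using r(1) l(1) e(1) v by simp
  then obtain t where t: "t > 0" "t < r" "t < l" "t < e / norm v"
    using dense by (metis min_less_iff_conj)
  have mem: "x + s *\<^sub>R v \<in> S" if "s \<in> {- t..t}" for s
  proof -
    have "\<bar>s\<bar> * norm v \<le> t * norm v"
      using that by (intro mult_right_mono) auto
    also have "\<dots> < e"
      using t(4) v by (simp add: field_simps)
    finally show ?thesis
      using e(2) by (auto simp: dist_norm)
  qed
  have "continuous_on S g"
    using diff by (intro continuous_at_imp_continuous_on ballI differentiable_imp_continuous_within)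
  then have cont: "continuous_on {- t..t} q"
    unfolding q_def
  proof (rule continuous_on_compose2)
    show "continuous_on {- t..t} (\<lambda>t. x + t *\<^sub>R v)"
      by (intro continuous_intros)
  qed (use mem in blast)
  have "{q (- t)<..<q t} \<subseteq> g ` S"
  proof
    fix y assume "y \<in> {q (- t)<..<q t}"
    then obtain s where "s \<in> {- t..t}" "q s = y"
      using IVT' [of q "- t" y t] cont t(1) by auto
    then show "y \<in> g ` S"
      using mem by (auto simp: q_def)
  qed
  moreover have "g x \<in> {q (- t)<..<q t}"
    using r(2) [of t] l(2) [of t] t by (simp add: q_def)
  ultimately show "\<exists>T. open T \<and> g x \<in> T \<and> T \<subseteq> g ` S"
    by (intro exI [of _ "{q (- t)<..<q t}"]) simp
qed

context
  fixes N :: "'a topology" and A :: "('a, 'n::finite) chart set"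
  assumes N: "smooth_manifold N A"
begin

lemma chart_inj:
  assumes "c \<in> A" shows "inj_on (chart_map c) (chart_dom c)"
proof -
  have "openin N (chart_dom c)"
    and "homeomorphic_map (subtopology N (chart_dom c)) (top_of_set (chart_image c)) (chart_map c)"
    using N assms by (auto simp: smooth_manifold_def)
  then show ?thesis
    using homeomorphic_imp_injective_map openin_subset topspace_subtopology_subset by metis
qed

lemma chart_inv_map: "c \<in> A \<Longrightarrow> p \<in> chart_dom c \<Longrightarrow> chart_inv c (chart_map c p) = p"
  using chart_inj by (simp add: inv_into_f_f)

lemma open_chart_image: "c \<in> A \<Longrightarrow> open (chart_image c)"
  using N by (auto simp: smooth_manifold_def)

lemma open_overlap:
  assumes "c \<in> A" "d \<in> A" shows "open (overlap c d)"
proof -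
  have o: "openin N (chart_dom c)" "openin N (chart_dom d)"
    and "homeomorphic_map (subtopology N (chart_dom c)) (top_of_set (chart_image c)) (chart_map c)"
    using N assms by (auto simp: smooth_manifold_def)
  then have "open_map (subtopology N (chart_dom c)) (top_of_set (chart_image c)) (chart_map c)"
    by (simp add: homeomorphic_imp_open_map)
  moreover have "openin (subtopology N (chart_dom c)) (chart_dom c \<inter> chart_dom d)"
    using o by (simp add: openin_open_subtopology openin_Int)
  ultimately have "openin (top_of_set (chart_image c)) (overlap c d)"
    by (auto simp: open_map_def)
  then show ?thesis
    using open_chart_image [OF assms(1)] by (simp add: openin_open_eq)
qed

lemma local_rep_chart: "c \<in> A \<Longrightarrow> p \<in> chart_dom c \<Longrightarrow> local_rep c f (chart_map c p) = f p"
  by (simp add: local_rep_def chart_inv_map)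

context
  fixes f :: "'a \<Rightarrow> real"
  assumes f: "\<And>c. c \<in> A \<Longrightarrow> Ck_on 1 (chart_image c) (local_rep c f)"
begin

lemma local_rep_differentiable:
  "c \<in> A \<Longrightarrow> x \<in> chart_image c \<Longrightarrow> local_rep c f differentiable (at x)"
  using Ck_on_1_differentiable [OF f] by blast

text \<open>\<open>regular_set\<close> asks for some chart with a nonzero differential, whereas
  computations in a given chart need it there. Since the representation in \<open>c\<close> is the
  one in \<open>d\<close> composed with the transition map, a zero derivative in \<open>d\<close>
  would force one in \<open>c\<close>.\<close>

lemma differential_nonzero_transfer:
  assumes c: "c \<in> A" and d: "d \<in> A" and p: "p \<in> chart_dom c" "p \<in> chart_dom d"
    and nz: "differential f c (chart_map c p) \<noteq> 0"
  shows "differential f d (chart_map d p) \<noteq> 0"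
proof
  assume z: "differential f d (chart_map d p) = 0"
  let ?x = "chart_map c p" and ?T = "transition c d"
  have x: "?x \<in> overlap c d" using p by blast
  have Tx: "?T ?x = chart_map d p"
    using c p by (simp add: transition_def chart_inv_map)
  have "?T differentiable (at ?x)"
    using N c d x by (intro smooth_on_differentiable [of "overlap c d"]) (auto simp: smooth_manifold_def)
  then have T: "(?T has_derivative frechet_derivative ?T (at ?x)) (at ?x)"
    by (simp add: frechet_derivative_works)
  have g: "local_rep d f differentiable (at (?T ?x))"
    using d p(2) unfolding Tx by (intro local_rep_differentiable) auto
  have "(\<chi> i. partial i (local_rep d f) (?T ?x)) = 0"
    using z unfolding Tx differential_def .
  then have "frechet_derivative (local_rep d f) (at (?T ?x)) = (\<lambda>_. 0)"
    by (simp add: fun_eq_iff frechet_derivative_eq_inner_partial [OF g])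
  then have "(local_rep d f has_derivative (\<lambda>_. 0)) (at (?T ?x))"
    using g by (simp add: frechet_derivative_works)
  from has_derivative_compose [OF T this]
  have D: "((\<lambda>z. local_rep d f (?T z)) has_derivative (\<lambda>_. 0)) (at ?x)" .
  have "(local_rep c f has_derivative (\<lambda>_. 0)) (at ?x)"
  proof (rule has_derivative_transform_within_open [OF D open_overlap [OF c d] x])
    fix z assume "z \<in> overlap c d"
    then obtain q where q: "q \<in> chart_dom c" "q \<in> chart_dom d" "z = chart_map c q"
      by auto
    then have "?T z = chart_map d q"
      using c by (simp add: transition_def chart_inv_map)
    then show "local_rep d f (?T z) = local_rep c f z"
      using c d q by (simp add: local_rep_chart)
  qed
  then have "differential f c ?x = 0"
    by (simp add: differential_def partial_eqI vec_eq_iff)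
  with nz show False by simp
qed

lemma regular_set_iff:
  assumes "c \<in> A" "p \<in> chart_dom c"
  shows "p \<in> regular_set A f \<longleftrightarrow> differential f c (chart_map c p) \<noteq> 0"
  using assms differential_nonzero_transfer unfolding regular_set_def by blast

lemma regular_image:
  assumes "c \<in> A"
  shows "chart_map c ` (chart_dom c \<inter> regular_set A f) = {x \<in> chart_image c. differential f c x \<noteq> 0}"
  using regular_set_iff [OF assms] by auto

lemma open_regular_image:
  assumes "c \<in> A"
  shows "open (chart_map c ` (chart_dom c \<inter> regular_set A f))"
proof -
  have "continuous_on (chart_image c) (differential f c)"
    using f [OF assms] unfolding differential_def [abs_def] partial_def
    by (intro continuous_on_vec_lambda) simp
  then have "open (chart_image c \<inter> differential f c -` (- {0}))"
    by (intro continuous_open_preimage open_chart_image assms) auto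
  also have "chart_image c \<inter> differential f c -` (- {0}) = chart_map c ` (chart_dom c \<inter> regular_set A f)"
    unfolding regular_image [OF assms] by auto
  finally show ?thesis .
qed

text \<open>Openness is proved chart by chart; it is what permits adding and subtracting smooth
  functions on the set of values.\<close>

lemma open_regular_values: "open (f ` regular_set A f)"
proof -
  have "f ` regular_set A f = (\<Union>c\<in>A. local_rep c f ` (chart_map c ` (chart_dom c \<inter> regular_set A f)))"
  proof -
    have "local_rep c f ` (chart_map c ` (chart_dom c \<inter> regular_set A f)) = f ` (chart_dom c \<inter> regular_set A f)"
      if "c \<in> A" for c
      unfolding image_image using that by (intro image_cong) (auto simp: local_rep_chart)
    then have "(\<Union>c\<in>A. local_rep c f ` (chart_map c ` (chart_dom c \<inter> regular_set A f)))
        = (\<Union>c\<in>A. f ` (chart_dom c \<inter> regular_set A f))"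
      by (intro SUP_cong refl)
    moreover have "f ` regular_set A f = (\<Union>c\<in>A. f ` (chart_dom c \<inter> regular_set A f))"
      unfolding image_UN [symmetric] by (rule arg_cong [of _ _ "image f"]) (auto simp: regular_set_def)
    ultimately show ?thesis
      by (simp only:)
  qed
  moreover have "open (local_rep c f ` (chart_map c ` (chart_dom c \<inter> regular_set A f)))" if "c \<in> A" for c
  proof (rule open_image_regular [OF open_regular_image [OF that]])
    fix x assume "x \<in> chart_map c ` (chart_dom c \<inter> regular_set A f)"
    then have "x \<in> chart_image c" "differential f c x \<noteq> 0"
      unfolding regular_image [OF that] by auto
    then show "local_rep c f differentiable (at x)" "(\<chi> i. partial i (local_rep c f) x) \<noteq> 0"
      using local_rep_differentiable [OF that] by (auto simp: differential_def)
  qed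
  ultimately show ?thesis
    by auto
qed

end

end

section \<open>The Riemannian density and the divergence of a homothetic field\<close>

lemma riem_density_derivative:
  assumes h: "h c differentiable (at x)"
    and sym: "transpose (h c x) = h c x" and pos: "\<And>y. y \<noteq> 0 \<Longrightarrow> 0 < y \<bullet> (h c x *v y)"
  shows "riem_density h c differentiable (at x)" and "riem_density h c x > 0"
    and "partial l (riem_density h c) x = riem_density h c x *
      (\<Sum>i\<in>UNIV. \<Sum>j\<in>UNIV. matrix_inv (h c x) $ j $ i * partial l (\<lambda>z. h c z $ i $ j) x) / 2"
proof -
  have d: "det (h c x) > 0" by (rule det_pos_def [OF sym pos])
  then show "riem_density h c x > 0" by (simp add: riem_density_def)
  have ent: "(\<lambda>z. h c z $ i $ j) differentiable (at x)" for i j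
    by (intro partial_vec_nth(2) h)
  have s: "(sqrt has_real_derivative inverse (sqrt (det (h c x))) / 2) (at (det (h c x)))"
    by (rule DERIV_real_sqrt [OF d])
  have eq: "riem_density h c = (\<lambda>z. sqrt (det (h c z)))"
    by (simp add: fun_eq_iff riem_density_def)
  show "riem_density h c differentiable (at x)"
    unfolding eq by (rule partial_compose_real(2) [OF differentiable_det [OF ent] s])
  have "partial l (riem_density h c) x = inverse (sqrt (det (h c x))) / 2 * partial l (\<lambda>z. det (h c z)) x"
    unfolding eq by (rule partial_compose_real(1) [OF differentiable_det [OF ent] s])
  also have "partial l (\<lambda>z. det (h c z)) x = det (h c x) *
      (\<Sum>i\<in>UNIV. \<Sum>j\<in>UNIV. matrix_inv (h c x) $ j $ i * partial l (\<lambda>z. h c z $ i $ j) x)"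
    using d by (intro partial_det ent) (simp add: invertible_det_nz)
  also have "inverse (sqrt (det (h c x))) / 2 * (det (h c x) * S) = sqrt (det (h c x)) * S / 2" for S
    using d by (simp add: field_simps)
  also have "sqrt (det (h c x)) = riem_density h c x"
    by (simp add: riem_density_def)
  finally show "partial l (riem_density h c) x = riem_density h c x *
      (\<Sum>i\<in>UNIV. \<Sum>j\<in>UNIV. matrix_inv (h c x) $ j $ i * partial l (\<lambda>z. h c z $ i $ j) x) / 2" .
qed

text \<open>Contract the homothety equation with the inverse metric. Symmetrizing does not change
  the trace of the covariant derivative, which is the divergence, and the trace of the metric itself
  is the dimension.\<close>

lemma divergence_homothetic:
  fixes h :: "('a, 'n::finite) metric_field" and W :: "('a, 'n) vec_field"
  assumes h: "h c differentiable (at x)" and W: "W c differentiable (at x)"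
    and sym: "transpose (h c x) = h c x" and pos: "\<And>y. y \<noteq> 0 \<Longrightarrow> 0 < y \<bullet> (h c x *v y)"
    and hom: "\<And>i j. (cov_deriv h W c x i j + cov_deriv h W c x j i) / 2 = - 2 * k * h c x $ i $ j"
  shows "divergence (riem_density h) W c x = - 2 * k * real CARD('n)"
proof -
  define H where "H i j = h c x $ i $ j" for i j
  define K where "K i j = matrix_inv (h c x) $ i $ j" for i j
  define dh where "dh l i j = partial l (\<lambda>z. h c z $ i $ j) x" for l i j
  define w where "w i = W c x $ i" for i
  define dw where "dw j i = partial j (\<lambda>z. W c z $ i) x" for j i
  note dens = riem_density_derivative [of h c x, OF h sym pos]
  have inv: "invertible (h c x)"
    using det_pos_def [OF sym pos] by (simp add: invertible_det_nz)
  have Hs: "H i j = H j i" for i j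
    using sym by (simp add: H_def) (metis (no_types, lifting) transpose_def vec_lambda_beta)
  have "transpose (matrix_inv (h c x)) = matrix_inv (h c x)"
  proof -
    have "transpose (matrix_inv (h c x)) ** h c x = mat 1"
      by (metis inv mult_matrix_inv(1) matrix_transpose_mul transpose_mat sym)
    then have "transpose (matrix_inv (h c x)) ** (h c x ** matrix_inv (h c x)) = matrix_inv (h c x)"
      by (simp add: matrix_mul_assoc)
    then show ?thesis
      by (simp add: mult_matrix_inv inv)
  qed
  then have Ks: "K i j = K j i" for i j
    by (simp add: K_def) (metis (no_types, lifting) transpose_def vec_lambda_beta)
  have KH: "(\<Sum>k\<in>UNIV. K k l * H k m) = (if l = m then 1 else 0)" for l m
  proof -
    have "(\<Sum>k\<in>UNIV. K k l * H k m) = (matrix_inv (h c x) ** h c x) $ l $ m"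
      by (simp add: Ks [of _ l]) (simp add: K_def H_def matrix_matrix_mult_def)
    then show ?thesis
      by (simp add: mult_matrix_inv inv mat_def)
  qed
  have hd: "(\<lambda>z. h c z $ i $ j) differentiable (at x)" for i j
    by (intro partial_vec_nth(2) h)
  have Wd: "(\<lambda>z. W c z $ i) differentiable (at x)" for i
    by (intro partial_vec_nth(2) W)
  have "cov_deriv h W c x i j = (\<Sum>k\<in>UNIV. dh j i k * w k + H i k * dw j k)
      - (\<Sum>k\<in>UNIV. (\<Sum>l\<in>UNIV. K k l / 2 * (dh i j l + dh j i l - dh l i j)) * (\<Sum>m\<in>UNIV. H k m * w m))" for i j
    unfolding cov_deriv_def christoffel_def lower_def
    by (simp add: partial_sum partial_mult hd Wd differentiable_mult H_def K_def dh_def w_def dw_def)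
  then have "(\<Sum>i\<in>UNIV. \<Sum>j\<in>UNIV. K i j * cov_deriv h W c x i j)
      = (\<Sum>j\<in>UNIV. dw j j) + (\<Sum>l\<in>UNIV. w l * (\<Sum>i\<in>UNIV. \<Sum>j\<in>UNIV. K i j * dh l i j)) / 2"
    using metric_trace_identity [of K H, OF Ks KH] by simp
  also have "\<dots> = divergence (riem_density h) W c x"
  proof -
    have "partial l (\<lambda>z. riem_density h c z * W c z $ l) x
        = riem_density h c x * (w l * (\<Sum>i\<in>UNIV. \<Sum>j\<in>UNIV. K i j * dh l i j) / 2 + dw l l)" for l
    proof -
      have "partial l (riem_density h c) x = riem_density h c x * (\<Sum>i\<in>UNIV. \<Sum>j\<in>UNIV. K i j * dh l i j) / 2"
        by (subst Ks) (unfold K_def dh_def, rule dens(3))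
      then show ?thesis
        using partial_mult [OF dens(1) Wd, of l l]
        by (simp add: w_def dw_def algebra_simps)
    qed
    then show ?thesis
      using dens(2) by (simp add: divergence_def sum_distrib_left [symmetric] sum.distrib sum_divide_distrib)
  qed
  finally have div: "(\<Sum>i\<in>UNIV. \<Sum>j\<in>UNIV. K i j * cov_deriv h W c x i j) = divergence (riem_density h) W c x" .
  \<comment> \<open>\<open>K\<close> is symmetric, so both halves of the symmetrized derivative have
    the same trace.\<close>
  have swap: "(\<Sum>i\<in>UNIV. \<Sum>j\<in>UNIV. K i j * cov_deriv h W c x j i) = (\<Sum>i\<in>UNIV. \<Sum>j\<in>UNIV. K i j * cov_deriv h W c x i j)"
    by (subst sum.swap) (simp add: Ks)
  have "2 * divergence (riem_density h) W c x
      = (\<Sum>i\<in>UNIV. \<Sum>j\<in>UNIV. K i j * (cov_deriv h W c x i j + cov_deriv h W c x j i))"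
    by (simp add: distrib_left sum.distrib swap div)
  also have "\<dots> = (\<Sum>i\<in>UNIV. \<Sum>j\<in>UNIV. (- 4 * k) * (K i j * H i j))"
  proof (intro sum.cong refl)
    fix i j
    have "cov_deriv h W c x i j + cov_deriv h W c x j i = - 4 * k * H i j"
      using hom [of i j] by (simp add: H_def)
    then show "K i j * (cov_deriv h W c x i j + cov_deriv h W c x j i) = (- 4 * k) * (K i j * H i j)"
      by simp
  qed
  also have "\<dots> = (- 4 * k) * (\<Sum>j\<in>UNIV. \<Sum>i\<in>UNIV. K i j * H i j)"
    by (subst (2) sum.swap) (simp only: sum_distrib_left)
  also have "\<dots> = - 4 * k * real CARD('n)"
    by (simp add: KH)
  finally show ?thesis by simp
qed

section \<open>The Randers Laplacian of a function isoparametric for the Riemannian metric\<close>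

context
  fixes N :: "'a topology" and A :: "('a, 'n::finite) chart set"
    and h :: "('a, 'n) metric_field" and W :: "('a, 'n) vec_field" and f :: "'a \<Rightarrow> real"
    and a b :: "real \<Rightarrow> real" and k :: real
  assumes N: "smooth_manifold N A" and nav: "navigation_data A h W"
    and hom: "\<And>c x i j. c \<in> A \<Longrightarrow> x \<in> chart_image c \<Longrightarrow>
        (cov_deriv h W c x i j + cov_deriv h W c x j i) / 2 = - 2 * k * h c x $ i $ j"
    and C1: "\<And>c. c \<in> A \<Longrightarrow> Ck_on 1 (chart_image c) (local_rep c f)"
    and smooth: "\<And>c. c \<in> A \<Longrightarrow> smooth_on (chart_map c ` (chart_dom c \<inter> regular_set A f)) (local_rep c f)"
    and norm_grad: "\<And>c p. c \<in> A \<Longrightarrow> p \<in> chart_dom c \<inter> regular_set A f \<Longrightarrow>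
        riem_norm h c (chart_map c p) (gradient (riem_norm h) f c (chart_map c p)) = a (f p)"
    and lap: "\<And>c p. c \<in> A \<Longrightarrow> p \<in> chart_dom c \<inter> regular_set A f \<Longrightarrow>
        laplacian (riem_norm h) (riem_density h) f c (chart_map c p) = b (f p)"
begin

lemma metric_sym: "c \<in> A \<Longrightarrow> x \<in> chart_image c \<Longrightarrow> transpose (h c x) = h c x"
  and metric_pos: "c \<in> A \<Longrightarrow> x \<in> chart_image c \<Longrightarrow> y \<noteq> 0 \<Longrightarrow> 0 < y \<bullet> (h c x *v y)"
  and metric_differentiable: "c \<in> A \<Longrightarrow> x \<in> chart_image c \<Longrightarrow> h c differentiable (at x)"
  and wind_differentiable: "c \<in> A \<Longrightarrow> x \<in> chart_image c \<Longrightarrow> W c differentiable (at x)"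
  and wind_less_one: "c \<in> A \<Longrightarrow> x \<in> chart_image c \<Longrightarrow> riem_norm h c x (W c x) < 1"
  using nav smooth_on_differentiable
  unfolding navigation_data_def riemannian_metric_def vector_field_def by blast+

abbreviation reg :: "('a, 'n) chart \<Rightarrow> (real^'n) set" where
  "reg c \<equiv> chart_map c ` (chart_dom c \<inter> regular_set A f)"

text \<open>Cramer's rule for \<open>h c z *v g = differential f c z\<close>. It agrees with the
  gradient of \<open>h\<close> on \<open>reg c\<close>, but its differentiability can be read off
  from the formula.\<close>

definition riem_grad :: "('a, 'n) vec_field" where
  "riem_grad c z = (\<chi> k. det (\<chi> i j. if j = k then differential f c z $ i else h c z $ i $ j) / det (h c z))"

lemma regD:
  assumes "c \<in> A" "x \<in> reg c"
  shows "x \<in> chart_image c" "differential f c x \<noteq> 0" "local_rep c f x \<in> f ` regular_set A f"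
proof -
  show "x \<in> chart_image c" "differential f c x \<noteq> 0"
    using assms(2) unfolding regular_image [OF N C1 assms(1), simplified] by auto
  show "local_rep c f x \<in> f ` regular_set A f"
    using assms local_rep_chart [OF N assms(1)] by auto
qed

lemma riem_grad:
  assumes "c \<in> A" "x \<in> reg c"
  shows "h c x *v riem_grad c x = differential f c x"
    and "gradient (riem_norm h) f c x = riem_grad c x"
    and "sqrt (differential f c x \<bullet> riem_grad c x) = a (local_rep c f x)"
    and "a (local_rep c f x) > 0"
    and "differential f c x \<bullet> riem_grad c x = (a (local_rep c f x))\<^sup>2"
    and "gradient (randers h W) f c x = (a (local_rep c f x) + differential f c x \<bullet> W c x) *\<^sub>R
      ((1 / a (local_rep c f x)) *\<^sub>R riem_grad c x + W c x)"
    and "randers h W c x (gradient (randers h W) f c x) = a (local_rep c f x) + differential f c x \<bullet> W c x"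
proof -
  note x = regD [OF assms]
  note sym = metric_sym [OF assms(1) x(1)] and pos = metric_pos [OF assms(1) x(1)]
    and w = wind_less_one [OF assms(1) x(1)]
  have "det (h c x) \<noteq> 0"
    using det_pos_def [OF sym pos] by simp
  then show s: "h c x *v riem_grad c x = differential f c x"
    by (simp add: cramer riem_grad_def)
  note g = gradient_riem [of h c x, OF sym pos x(2) s]
  note r = gradient_randers [of h c x W, OF sym pos w x(2) s]
  show "gradient (riem_norm h) f c x = riem_grad c x"
    by (rule g)
  obtain p where p: "p \<in> chart_dom c \<inter> regular_set A f" "x = chart_map c p"
    using assms(2) by auto
  then have "a (local_rep c f x) = riem_norm h c x (gradient (riem_norm h) f c x)"
    using norm_grad [OF assms(1) p(1)] local_rep_chart [OF N assms(1)] by simp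
  then show n: "sqrt (differential f c x \<bullet> riem_grad c x) = a (local_rep c f x)"
    using g(2) by simp
  show pos_a: "a (local_rep c f x) > 0"
    using r(1) n by simp
  then show "differential f c x \<bullet> riem_grad c x = (a (local_rep c f x))\<^sup>2"
    unfolding n [symmetric] by simp
  show "gradient (randers h W) f c x = (a (local_rep c f x) + differential f c x \<bullet> W c x) *\<^sub>R
      ((1 / a (local_rep c f x)) *\<^sub>R riem_grad c x + W c x)"
    using r(2) unfolding n .
  show "randers h W c x (gradient (randers h W) f c x) = a (local_rep c f x) + differential f c x \<bullet> W c x"
    using r(3) unfolding n .
qed

lemma riem_grad_differentiable:
  assumes "c \<in> A" "x \<in> reg c"
  shows "riem_grad c differentiable (at x)"
  unfolding riem_grad_def [abs_def]
proof (rule differentiable_solution)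
  note x = regD [OF assms]
  show "(\<lambda>z. h c z $ i $ j) differentiable (at x)" for i j
    using metric_differentiable [OF assms(1) x(1)] by (intro partial_vec_nth(2))
  show "(\<lambda>z. differential f c z $ i) differentiable (at x)" for i
    using smooth_on_partial_differentiable [OF smooth [OF assms(1)] assms(2)] by (simp add: differential_def)
  show "det (h c x) \<noteq> 0"
    using det_pos_def [of "h c x", OF metric_sym metric_pos] assms(1) x(1) by (metis less_irrefl)
qed

lemma a_pos: "y \<in> f ` regular_set A f \<Longrightarrow> a y > 0"
proof -
  assume "y \<in> f ` regular_set A f"
  then obtain c p where "c \<in> A" "p \<in> chart_dom c \<inter> regular_set A f" "y = f p"
    by (auto simp: regular_set_def)
  then show "a y > 0"
    using riem_grad(4) [of c "chart_map c p"] local_rep_chart [OF N, of c p f] by auto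
qed

text \<open>The gradient is \<open>u\<close> times the Riemannian gradient plus \<open>v\<close>
  times \<open>W\<close>, where \<open>u = \<psi> / a\<close> and \<open>v = \<psi>\<close> are
  functions of \<open>f\<close>. The product rule gives four terms: each coefficient times a known
  divergence, and the derivative of each coefficient times \<open>df\<close> of the field, which is
  \<open>(a y)\<^sup>2\<close> for the gradient and \<open>\<phi> y\<close> for
  \<open>W\<close>.\<close>

lemma laplacian_randers:
  assumes c: "c \<in> A" and x: "x \<in> reg c"
    and wind: "\<And>z. z \<in> reg c \<Longrightarrow> differential f c z \<bullet> W c z = \<phi> (local_rep c f z)"
    and a': "(a has_real_derivative a') (at (local_rep c f x))"
    and \<phi>': "(\<phi> has_real_derivative \<phi>') (at (local_rep c f x))"
  defines "y \<equiv> local_rep c f x"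
  defines "\<psi> \<equiv> a y + \<phi> y" and "\<psi>' \<equiv> a' + \<phi>'"
  shows "laplacian (randers h W) (BH_density (randers h W)) f c x
    = \<psi> / a y * b y + (\<psi>' * a y - \<psi> * a') - 2 * k * real CARD('n) * \<psi> + \<psi>' * \<phi> y"
proof -
  note xr = regD [OF c x]
  have opn: "open (reg c)"
    by (rule open_regular_image [OF N C1 c])
  define u where "u d z = (a (local_rep d f z) + \<phi> (local_rep d f z)) / a (local_rep d f z)"
    for d :: "('a, 'n) chart" and z
  define v where "v d z = a (local_rep d f z) + \<phi> (local_rep d f z)"
    for d :: "('a, 'n) chart" and z
  have ay: "a y > 0"
    using a_pos xr(3) by (simp add: y_def)
  note dens = riem_density_derivative [of h c x, OF metric_differentiable [OF c xr(1)] metric_sym [OF c xr(1)]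
      metric_pos [OF c xr(1)]]
  have dens_pos: "riem_density h c x \<noteq> 0"
  proof -
    have "riem_density h c x > 0" by (rule dens(2))
    then show ?thesis by simp
  qed
  have Gd: "riem_grad c differentiable (at x)"
    by (rule riem_grad_differentiable [OF c x])
  have Wd: "W c differentiable (at x)"
    by (rule wind_differentiable [OF c xr(1)])
  have fd: "local_rep c f differentiable (at x)"
    by (rule smooth_on_differentiable [OF smooth [OF c] x])
  have du: "((\<lambda>t. (a t + \<phi> t) / a t) has_real_derivative (\<psi>' * a y - \<psi> * a') / (a y)\<^sup>2) (at (local_rep c f x))"
    using ay by (auto intro!: derivative_eq_intros a' \<phi>' simp: \<psi>_def \<psi>'_def y_def power2_eq_square)
  have dv: "((\<lambda>t. a t + \<phi> t) has_real_derivative \<psi>') (at (local_rep c f x))"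
    by (auto intro!: derivative_eq_intros a' \<phi>' simp: \<psi>'_def)
  have ud: "u c differentiable (at x)"
    unfolding u_def [abs_def] by (rule partial_compose_real(2) [OF fd du])
  have vd: "v c differentiable (at x)"
    unfolding v_def [abs_def] by (rule partial_compose_real(2) [OF fd dv])
  have up: "partial i (u c) x = (\<psi>' * a y - \<psi> * a') / (a y)\<^sup>2 * differential f c x $ i" for i
    unfolding u_def [abs_def] differential_def by (simp add: partial_compose_real(1) [OF fd du])
  have vp: "partial i (v c) x = \<psi>' * differential f c x $ i" for i
    unfolding v_def [abs_def] differential_def by (simp add: partial_compose_real(1) [OF fd dv])
  have "laplacian (randers h W) (BH_density (randers h W)) f c x
      = divergence (riem_density h) (\<lambda>d z. u d z *\<^sub>R riem_grad d z + v d z *\<^sub>R W d z) c x"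
    unfolding laplacian_def
  \<comment> \<open>The formulas for density and gradient hold at regular points only; a whole
    neighbourhood of \<open>x\<close> is regular, which is enough for the divergence at
    \<open>x\<close>.\<close>
  proof (rule divergence_cong_open [OF opn x])
    fix z assume z: "z \<in> reg c"
    note zr = regD [OF c z]
    show "BH_density (randers h W) c z = riem_density h c z"
      by (rule BH_density_eq_riem_density [of h c z W, OF metric_sym [OF c zr(1)] metric_pos [OF c zr(1)]
            wind_less_one [OF c zr(1)]])
    show "gradient (randers h W) f c z = u c z *\<^sub>R riem_grad c z + v c z *\<^sub>R W c z"
      by (simp add: riem_grad(6) [OF c z] wind [OF z] u_def v_def scaleR_add_right)
  qed
  also have "\<dots> = divergence (riem_density h) (\<lambda>d z. u d z *\<^sub>R riem_grad d z) c x
      + divergence (riem_density h) (\<lambda>d z. v d z *\<^sub>R W d z) c x"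
    by (intro divergence_add dens(1) differentiable_scaleR ud vd Gd Wd)
  also have "divergence (riem_density h) (\<lambda>d z. u d z *\<^sub>R riem_grad d z) c x
      = u c x * divergence (riem_density h) riem_grad c x + (\<Sum>i\<in>UNIV. partial i (u c) x * riem_grad c x $ i)"
    by (intro divergence_scale dens(1) ud Gd dens_pos)
  also have "divergence (riem_density h) (\<lambda>d z. v d z *\<^sub>R W d z) c x
      = v c x * divergence (riem_density h) W c x + (\<Sum>i\<in>UNIV. partial i (v c) x * W c x $ i)"
    by (intro divergence_scale dens(1) vd Wd dens_pos)
  also have "divergence (riem_density h) riem_grad c x = b y"
  proof -
    have "divergence (riem_density h) riem_grad c x = laplacian (riem_norm h) (riem_density h) f c x"
      unfolding laplacian_def by (rule divergence_cong_open [OF opn x]) (simp_all add: riem_grad(2) [OF c])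
    also obtain p where p: "p \<in> chart_dom c \<inter> regular_set A f" "x = chart_map c p"
      using x by auto
    then have "laplacian (riem_norm h) (riem_density h) f c x = b y"
      using lap [OF c p(1)] local_rep_chart [OF N c] by (simp add: y_def)
    finally show ?thesis .
  qed
  also have "divergence (riem_density h) W c x = - 2 * k * real CARD('n)"
    by (rule divergence_homothetic [OF metric_differentiable [OF c xr(1)] Wd metric_sym [OF c xr(1)]
          metric_pos [OF c xr(1)] hom [OF c xr(1)]])
  also have "(\<Sum>i\<in>UNIV. partial i (u c) x * riem_grad c x $ i)
      = (\<psi>' * a y - \<psi> * a') / (a y)\<^sup>2 * (differential f c x \<bullet> riem_grad c x)"
    by (simp only: up inner_vec_def sum_distrib_left inner_real_def mult.assoc)
  \<comment> \<open>The squared length of the Riemannian gradient cancels the denominator from the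
    quotient rule.\<close>
  also have "\<dots> = \<psi>' * a y - \<psi> * a'"
    using ay by (simp add: riem_grad(5) [OF c x] y_def)
  also have "(\<Sum>i\<in>UNIV. partial i (v c) x * W c x $ i) = \<psi>' * (differential f c x \<bullet> W c x)"
    by (simp only: vp inner_vec_def sum_distrib_left inner_real_def mult.assoc)
  also have "differential f c x \<bullet> W c x = \<phi> y"
    using wind [OF x] by (simp add: y_def)
  finally show ?thesis
    by (simp add: u_def v_def y_def \<psi>_def)
qed

end

theorem theorem3p9:
  fixes N :: "'a topology"
    and A :: "('a, 'n::finite) chart set"
    and h :: "('a, 'n) metric_field"
    and W :: "('a, 'n) vec_field"
    and f :: "'a \<Rightarrow> real"
  assumes "smooth_manifold N A"
    and "navigation_data A h W"
    and "homothetic A h W"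
    and "isoparametric A (riem_norm h) (riem_density h) f"
  shows "isoparametric A (randers h W) (BH_density (randers h W)) f \<longleftrightarrow>
    (\<exists>\<phi>::real \<Rightarrow> real. smooth_on (f ` regular_set A f) \<phi> \<and>
      (\<forall>c\<in>A. \<forall>p\<in>chart_dom c \<inter> regular_set A f.
         differential f c (chart_map c p) \<bullet> W c (chart_map c p) = \<phi> (f p)))"
proof -
  let ?S = "f ` regular_set A f"
  obtain k where hom: "\<And>c x i j. c \<in> A \<Longrightarrow> x \<in> chart_image c \<Longrightarrow>
      (cov_deriv h W c x i j + cov_deriv h W c x j i) / 2 = - 2 * k * h c x $ i $ j"
    using assms(3) unfolding homothetic_def by blast
  obtain a b where sm_a: "smooth_on ?S a" and cont_b: "continuous_on ?S b"
    and ng: "\<And>c p. c \<in> A \<Longrightarrow> p \<in> chart_dom c \<inter> regular_set A f \<Longrightarrow>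
        riem_norm h c (chart_map c p) (gradient (riem_norm h) f c (chart_map c p)) = a (f p)"
    and lp: "\<And>c p. c \<in> A \<Longrightarrow> p \<in> chart_dom c \<inter> regular_set A f \<Longrightarrow>
        laplacian (riem_norm h) (riem_density h) f c (chart_map c p) = b (f p)"
    using assms(4) unfolding isoparametric_def Let_def by blast
  have nc: "\<not> f constant_on (\<Union>c\<in>A. chart_dom c)"
    and C1: "\<And>c. c \<in> A \<Longrightarrow> Ck_on 1 (chart_image c) (local_rep c f)"
    and sm: "\<And>c. c \<in> A \<Longrightarrow> smooth_on (chart_map c ` (chart_dom c \<inter> regular_set A f)) (local_rep c f)"
    using assms(4) unfolding isoparametric_def by blast+
  note ctx = assms(1,2) hom C1 sm ng lp
  have S: "open ?S"
    by (rule open_regular_values [OF assms(1) C1])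
  have lr: "local_rep c f (chart_map c p) = f p" if "c \<in> A" "p \<in> chart_dom c" for c p
    using local_rep_chart [OF assms(1)] that by blast
  have F_grad: "randers h W c (chart_map c p) (gradient (randers h W) f c (chart_map c p))
      = a (f p) + differential f c (chart_map c p) \<bullet> W c (chart_map c p)"
    if "c \<in> A" "p \<in> chart_dom c \<inter> regular_set A f" for c p
    using riem_grad(7) [OF ctx that(1) imageI [OF that(2)]] lr that by simp
  show ?thesis
  proof
    assume "isoparametric A (randers h W) (BH_density (randers h W)) f"
    then obtain a2 where "smooth_on ?S a2" and a2: "\<And>c p. c \<in> A \<Longrightarrow> p \<in> chart_dom c \<inter> regular_set A f \<Longrightarrow>
        randers h W c (chart_map c p) (gradient (randers h W) f c (chart_map c p)) = a2 (f p)"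
      unfolding isoparametric_def Let_def by blast
    then have "smooth_on ?S (\<lambda>y. a2 y - a y)"
      using smooth_on_diff S sm_a by blast
    moreover have "differential f c (chart_map c p) \<bullet> W c (chart_map c p) = a2 (f p) - a (f p)"
      if "c \<in> A" "p \<in> chart_dom c \<inter> regular_set A f" for c p
      using F_grad [OF that] a2 [OF that] by simp
    ultimately show "\<exists>\<phi>. smooth_on ?S \<phi> \<and> (\<forall>c\<in>A. \<forall>p\<in>chart_dom c \<inter> regular_set A f.
        differential f c (chart_map c p) \<bullet> W c (chart_map c p) = \<phi> (f p))"
      by (intro exI [of _ "\<lambda>y. a2 y - a y"]) blast
  next
    assume "\<exists>\<phi>. smooth_on ?S \<phi> \<and> (\<forall>c\<in>A. \<forall>p\<in>chart_dom c \<inter> regular_set A f.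
        differential f c (chart_map c p) \<bullet> W c (chart_map c p) = \<phi> (f p))"
    then obtain \<phi> where sm_\<phi>: "smooth_on ?S \<phi>"
      and wind: "\<And>c p. c \<in> A \<Longrightarrow> p \<in> chart_dom c \<inter> regular_set A f \<Longrightarrow>
        differential f c (chart_map c p) \<bullet> W c (chart_map c p) = \<phi> (f p)"
      by blast
    obtain a' where a': "continuous_on ?S a'" "\<And>t. t \<in> ?S \<Longrightarrow> (a has_real_derivative a' t) (at t)"
      using smooth_on_real_derivative [OF sm_a] by blast
    obtain \<phi>' where \<phi>': "continuous_on ?S \<phi>'" "\<And>t. t \<in> ?S \<Longrightarrow> (\<phi> has_real_derivative \<phi>' t) (at t)"
      using smooth_on_real_derivative [OF sm_\<phi>] by blast
    \<comment> \<open>The right side of \<open>laplacian_randers\<close> as a function of the value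
      \<open>t\<close> of \<open>f\<close>; it is continuous because \<open>a\<close> is positive on
      the values at regular points and the derivatives of \<open>a\<close> and \<phi> are
      continuous.\<close>
    define B where "B t = (a t + \<phi> t) / a t * b t + ((a' t + \<phi>' t) * a t - (a t + \<phi> t) * a' t)
        - 2 * k * real CARD('n) * (a t + \<phi> t) + (a' t + \<phi>' t) * \<phi> t" for t
    have "continuous_on ?S a" "continuous_on ?S \<phi>"
      using Ck_on_imp_continuous_on smooth_on_Ck_on sm_a sm_\<phi> by blast+
    moreover have "a t \<noteq> 0" if "t \<in> ?S" for t
      using a_pos [OF ctx that] by simp
    ultimately have "continuous_on ?S B"
      unfolding B_def [abs_def] by (intro continuous_intros a' \<phi>' cont_b) auto
    moreover have "smooth_on ?S (\<lambda>t. a t + \<phi> t)"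
      by (rule smooth_on_add [OF S sm_a sm_\<phi>])
    moreover have "randers h W c (chart_map c p) (gradient (randers h W) f c (chart_map c p)) = a (f p) + \<phi> (f p)"
      and "laplacian (randers h W) (BH_density (randers h W)) f c (chart_map c p) = B (f p)"
      if c: "c \<in> A" and p: "p \<in> chart_dom c \<inter> regular_set A f" for c p
    proof -
      show "randers h W c (chart_map c p) (gradient (randers h W) f c (chart_map c p)) = a (f p) + \<phi> (f p)"
        using F_grad [OF c p] wind [OF c p] by simp
      have fp: "local_rep c f (chart_map c p) = f p" "f p \<in> ?S"
        using lr c p by auto
      have wind': "differential f c z \<bullet> W c z = \<phi> (local_rep c f z)"
        if "z \<in> chart_map c ` (chart_dom c \<inter> regular_set A f)" for z
        using that wind [OF c] lr [OF c] by auto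
      have "laplacian (randers h W) (BH_density (randers h W)) f c (chart_map c p)
          = B (local_rep c f (chart_map c p))"
        unfolding B_def
        by (rule laplacian_randers [where N = N and A = A])
          (assumption | rule ctx c imageI [OF p] wind' a' \<phi>' fp(2) | simp only: fp(1))+
      then show "laplacian (randers h W) (BH_density (randers h W)) f c (chart_map c p) = B (f p)"
        unfolding fp .
    qed
    ultimately have "\<exists>a b. smooth_on ?S a \<and> continuous_on ?S b \<and>
        (\<forall>c\<in>A. \<forall>p\<in>chart_dom c \<inter> regular_set A f.
          randers h W c (chart_map c p) (gradient (randers h W) f c (chart_map c p)) = a (f p) \<and>
          laplacian (randers h W) (BH_density (randers h W)) f c (chart_map c p) = b (f p))"
      by (intro exI [of _ "\<lambda>t. a t + \<phi> t"] exI [of _ B]) simp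
    then show "isoparametric A (randers h W) (BH_density (randers h W)) f"
      unfolding isoparametric_def Let_def using nc C1 sm by blast
  qed
qed

end
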